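(* Let $\mathfrak g$ be a simple complex Lie algebra, $\Bbbk$ a field, and let $B_\epsilon,B_{\epsilon'}$ be tensor words in the fundamental crystals of $\mathfrak g$. Then the set $$\mathcal B(\epsilon,\epsilon')=\{\overline f\circ P\circ g\mid f\in\mathcal D_{\epsilon',\lambda},\ g\in\mathcal D_{\epsilon,\lambda},\ \lambda\in\Lambda_+\},$$ where for each pair $(f,g)$ the morphism $P$ is a permutation, built from crossings, from the codomain of $g$ to the codomain of $f$, is a basis of the $\Bbbk$-vector space $\mathrm{Hom}_{\mathfrak g\text{-}\mathrm{Crys}}(B_\epsilon,B_{\epsilon'})$.
   Context: **Crystals.** $\mathfrak g$ has simple roots $\alpha_i$, simple coroots $\alpha_i^\vee$ ($1\le i\le n$), weight lattice $\Lambda$, dominant weights $\Lambda_+$, fundamental weights $\omega_i$. A $\mathfrak g$-crystal is a finite set $B$ with maps $\mathrm{wt}:B\to\Lambda$, $e_i,f_i:B\to B\sqcup\{0\}$ such that $\mathrm{wt}(e_ib)=\mathrm{wt}(b)+\alpha_i$ if $e_ib\ne0$, $\mathrm{wt}(f_ib)=\mathrm{wt}(b)-\alpha_i$ if $f_ib\ne0$; $e_ib=b'\iff b=f_ib'$; and $\varphi_i(b)-\varepsilon_i(b)=\langle\mathrm{wt}(b),\alpha_i^\vee\rangle$, where $\varepsilon_i(b)=\max\{m:e_i^mb\ne0\}$, $\varphi_i(b)=\max\{m:f_i^mb\ne0\}$. The tensor product $B\otimes C$ is $B\times C$ with $\mathrm{wt}(b\otimes c)=\mathrm{wt}(b)+\mathrm{wt}(c)$,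 $e_i(b\otimes c)=e_ib\otimes c$ if $\varphi_i(b)\ge\varepsilon_i(c)$ and $b\otimes e_ic$ otherwise, $f_i(b\otimes c)=f_ib\otimes c$ if $\varphi_i(b)>\varepsilon_i(c)$ and $b\otimes f_ic$ otherwise. A (strict) morphism is a map $B\sqcup\{0\}\to C\sqcup\{0\}$ with $0\mapsto0$, preserving weights (of elements not sent to $0$) and commuting with all $e_i,f_i$. $B(\lambda)$ is the connected crystal of the simple module of highest weight $\lambda\in\Lambda_+$; $B_i:=B(\omega_i)$. $\mathfrak g$-Crys is the (strictified) $\Bbbk$-linear monoidal category with objects finite direct sums (disjoint unions) of crystals $B(\lambda)$ and morphisms the $\Bbbk$-linear combinations of crystal morphisms (viewed as linear maps between the $\Bbbk$-spans, $0\mapsto0$). For a word $\epsilon=(\epsilon_1,\dots,\epsilon_m)$ in $\{1,\dots,n\}$, $B_\epsilon=B_{\epsilon_1}\otimes\cdots\otimes B_{\epsilon_m}$ (empty word: unit $\mathbb 1$). The top component of $B_\epsilon$ is its unique component of highest weight $\sum_k\omega_{\epsilon_k}$ (the weight of $B_\epsilon$); its highest weight element is the highest element of $B_\epsilon$. **Atoms.** For $b\in B_k$ let $B_{\epsilon(b)}=B_1^{\otimes\varepsilon_1(b)}\otimes\cdots\otimes B_n^{\otimes\varepsilon_n(b)}$, $B_{\delta(b)}=B_1^{\otimes\varphi_1(b)}\otimes\cdots\otimes B_n^{\otimes\varphi_n(b)}$, and $c$ the highest element of $B_{\epsilon(b)}$. The atom $f_b:B_{\epsilon(b)}\otimes B_k\to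 B_{\delta(b)}$ maps the component generated by the highest weight element $c\otimes b$ onto the top component of $B_{\delta(b)}$ and is zero on all other components. **Crossings and permutations.** Crossings are one fixed choice of isomorphisms $\beta_{i,j}:B_i\otimes B_j\to B_j\otimes B_i$ for $i\ne j$, with $\beta_{i,j}^{-1}=\beta_{j,i}$. A permutation is a composite of identity-padded crossings rearranging the factors of a tensor word; as a fixed convention (the result does not depend on the choice, but one $P$ is fixed for each pair), strands of equal label never cross, two strands cross at most once, and three completely reversed strands with distinct labels $i,j,k$ are reversed by $(\beta_{j,k}\otimes\mathrm{id})(\mathrm{id}\otimes\beta_{i,k})(\beta_{i,j}\otimes\mathrm{id})$. **Flip.** If $f$ is a map of crystals injective outside its kernel (as atoms, crossings and their composites/tensor products are), $\overline f$ is the map in the opposite direction inverting $f$ on its image and sending all other elements to $0$. **Distinguished bottom diagrams.** $\mathcal D_\epsilon$ is defined recursively: for the empty word it contains only the empty morphism. A connected component of $B_{\epsilon_1}\otimes\cdots\otimes B_{\epsilon_m}$ has highest weight element $b_1\otimes\cdots\otimes b_m$, whose prefixes are all highest weight elements. If $D'$ is the diagram attached to the component of $b_1\otimes\cdots\otimes b_{m-1}$, the diagram attached to that of $b_1\otimes\cdots\otimes b_m$ is $(\mathrm{id}\otimes f_{b_m})\circ((\beta\circ D')\otimes\mathrm{id}_{B_{\epsilon_m}})$, where $\beta$ is a minimal permutation (fewest crossings) such that the rightmost factors of its codomain form the word $B_{\epsilon(b_m)}$. The weight of $D\in\mathcal D_\epsilon$ is the weight of its codomain; $\mathcal D_{\epsilon,\lambda}=\{D\in\mathcal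 D_\epsilon:\mathrm{wt}(D)=\lambda\}$. *)

theory Defs
  imports Complex_Main "HOL-Library.Function_Algebras"
    "HOL-Computational_Algebra.Polynomial" "HOL-Computational_Algebra.Fraction_Field"
begin

section \<open>Simple complex Lie algebras\<close>

locale lie_algebra = vector_space scale
  for scale :: "complex \<Rightarrow> 'g::ab_group_add \<Rightarrow> 'g" +
  fixes br :: "'g \<Rightarrow> 'g \<Rightarrow> 'g"
  assumes br_add_left: "br (x + y) z = br x z + br y z"
    and br_scale_left: "br (scale a x) z = scale a (br x z)"
    and br_add_right: "br z (x + y) = br z x + br z y"
    and br_scale_right: "br z (scale a x) = scale a (br z x)"
    and br_self: "br x x = 0"
    and jacobi: "br x (br y z) + br y (br z x) + br z (br x y) = 0"
    and finite_dim: "\<exists>S. finite S \<and> span S = UNIV"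
begin

definition lie_ideal :: "'g set \<Rightarrow> bool" where
  "lie_ideal I \<longleftrightarrow> subspace I \<and> (\<forall>x. \<forall>y\<in>I. br x y \<in> I)"

definition toral :: "'g set \<Rightarrow> bool" where
  "toral H \<longleftrightarrow> subspace H \<and> (\<forall>h\<in>H. \<forall>h'\<in>H. br h h' \<in> H)
     \<and> (\<forall>h\<in>H. span {x. \<exists>c. br h x = scale c x} = UNIV)"

text \<open>For semisimple algebras the Cartan subalgebras are the maximal toral ones.\<close>
definition cartan_subalgebra :: "'g set \<Rightarrow> bool" where
  "cartan_subalgebra H \<longleftrightarrow> toral H \<and> (\<forall>H'. toral H' \<longrightarrow> H \<subseteq> H' \<longrightarrow> H' = H)"

text \<open>Linear functionals on \<open>H\<close> are functions whose values outside \<open>H\<close> are irrelevant.\<close>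
definition functional_on :: "'g set \<Rightarrow> ('g \<Rightarrow> complex) \<Rightarrow> bool" where
  "functional_on H \<gamma> \<longleftrightarrow> (\<forall>x\<in>H. \<forall>y\<in>H. \<gamma> (x + y) = \<gamma> x + \<gamma> y)
     \<and> (\<forall>c. \<forall>x\<in>H. \<gamma> (scale c x) = c * \<gamma> x)"

definition root_space :: "'g set \<Rightarrow> ('g \<Rightarrow> complex) \<Rightarrow> 'g set" where
  "root_space H \<gamma> = {x. \<forall>h\<in>H. br h x = scale (\<gamma> h) x}"

definition is_root :: "'g set \<Rightarrow> ('g \<Rightarrow> complex) \<Rightarrow> bool" where
  "is_root H \<gamma> \<longleftrightarrow> functional_on H \<gamma> \<and> (\<exists>h\<in>H. \<gamma> h \<noteq> 0) \<and> root_space H \<gamma> \<noteq> {0}"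

definition simple_roots :: "'g set \<Rightarrow> ('n::finite \<Rightarrow> 'g \<Rightarrow> complex) \<Rightarrow> bool" where
  "simple_roots H \<alpha> \<longleftrightarrow> (\<forall>i. is_root H (\<alpha> i))
     \<and> (\<forall>c. (\<forall>h\<in>H. (\<Sum>i\<in>UNIV. c i * \<alpha> i h) = 0) \<longrightarrow> (\<forall>i. c i = 0))
     \<and> (\<forall>\<gamma>. is_root H \<gamma> \<longrightarrow> (\<exists>c :: 'n \<Rightarrow> nat.
           (\<forall>h\<in>H. \<gamma> h = (\<Sum>i\<in>UNIV. of_nat (c i) * \<alpha> i h))
         \<or> (\<forall>h\<in>H. \<gamma> h = - (\<Sum>i\<in>UNIV. of_nat (c i) * \<alpha> i h))))"

definition is_coroot :: "'g set \<Rightarrow> ('g \<Rightarrow> complex) \<Rightarrow> 'g \<Rightarrow> bool" where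
  "is_coroot H \<gamma> h \<longleftrightarrow> h \<in> H \<and> \<gamma> h = 2
     \<and> (\<exists>x\<in>root_space H \<gamma>. \<exists>y\<in>root_space H (\<lambda>h. - \<gamma> h). h = br x y)"

end

text \<open>A simple Lie algebra with a Cartan subalgebra, simple roots and simple coroots.  The rank
  is the cardinality of the index type, whose linear order is the numbering \<open>1, \<dots>, n\<close>.\<close>
locale simple_lie_algebra = lie_algebra scale br
  for scale :: "complex \<Rightarrow> 'g::ab_group_add \<Rightarrow> 'g" and br +
  fixes H :: "'g set"
    and \<alpha> :: "'n::{finite,linorder} \<Rightarrow> 'g \<Rightarrow> complex"
    and coroot :: "'n \<Rightarrow> 'g"
  assumes nonabelian: "\<exists>x y. br x y \<noteq> 0"
    and simple: "lie_ideal I \<Longrightarrow> I = {0} \<or> I = UNIV"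
    and cartan: "cartan_subalgebra H"
    and roots: "simple_roots H \<alpha>"
    and coroots: "is_coroot H (\<alpha> i) (coroot i)"

text \<open>The entry \<open>(i, j)\<close> is the integer \<open>\<langle>\<alpha>\<^sub>j, \<alpha>\<^sub>i\<^sup>\<or>\<rangle>\<close>.\<close>
definition cartan_matrix :: "('n \<Rightarrow> 'g \<Rightarrow> complex) \<Rightarrow> ('n \<Rightarrow> 'g) \<Rightarrow> 'n \<Rightarrow> 'n \<Rightarrow> int" where
  "cartan_matrix \<alpha> coroot i j = (THE z. \<alpha> j (coroot i) = of_int z)"


section \<open>Weights\<close>

text \<open>The simple coroots form a basis of \<open>H\<close>, so a weight \<open>\<mu> \<in> \<Lambda>\<close> is given by the
  integers \<open>\<mu> i = \<langle>\<mu>, \<alpha>\<^sub>i\<^sup>\<or>\<rangle>\<close>, i.e. by its coordinates in the basis of fundamental weights.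
  Throughout, \<open>A\<close> is the Cartan matrix.\<close>

type_synonym 'n weight = "'n \<Rightarrow> int"

definition dominant :: "'n weight \<Rightarrow> bool" where
  "dominant \<mu> \<longleftrightarrow> (\<forall>i. 0 \<le> \<mu> i)"

definition root_weight :: "('n \<Rightarrow> 'n \<Rightarrow> int) \<Rightarrow> 'n \<Rightarrow> 'n weight" where
  "root_weight A i = (\<lambda>j. A j i)"

definition fund_weight :: "'n \<Rightarrow> 'n weight" where
  "fund_weight i = (\<lambda>j. if j = i then 1 else 0)"


section \<open>Crystals\<close>

text \<open>\<open>None\<close> plays the role of the extra element \<open>0\<close>.\<close>

record ('n, 'b) crystal =
  elts :: "'b set"
  wt :: "'b \<Rightarrow> 'n weight"
  eop :: "'n \<Rightarrow> 'b \<Rightarrow> 'b option"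
  fop :: "'n \<Rightarrow> 'b \<Rightarrow> 'b option"

definition iter :: "('b \<Rightarrow> 'b option) \<Rightarrow> nat \<Rightarrow> 'b \<Rightarrow> 'b option" where
  "iter g m b = ((\<lambda>x. Option.bind x g) ^^ m) (Some b)"

definition eps :: "('n, 'b) crystal \<Rightarrow> 'n \<Rightarrow> 'b \<Rightarrow> nat" where
  "eps C i b = Max {m. iter (eop C i) m b \<noteq> None}"

definition phi :: "('n, 'b) crystal \<Rightarrow> 'n \<Rightarrow> 'b \<Rightarrow> nat" where
  "phi C i b = Max {m. iter (fop C i) m b \<noteq> None}"

definition is_crystal :: "('n \<Rightarrow> 'n \<Rightarrow> int) \<Rightarrow> ('n, 'b) crystal \<Rightarrow> bool" where
  "is_crystal A C \<longleftrightarrow> finite (elts C)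
     \<and> (\<forall>b\<in>elts C. \<forall>i b'. eop C i b = Some b' \<longrightarrow>
          b' \<in> elts C \<and> wt C b' = wt C b + root_weight A i)
     \<and> (\<forall>b\<in>elts C. \<forall>i b'. fop C i b = Some b' \<longrightarrow>
          b' \<in> elts C \<and> wt C b' = wt C b - root_weight A i)
     \<and> (\<forall>b\<in>elts C. \<forall>b'\<in>elts C. \<forall>i. eop C i b = Some b' \<longleftrightarrow> fop C i b' = Some b)
     \<and> (\<forall>b\<in>elts C. \<forall>i. int (phi C i b) - int (eps C i b) = wt C b i)"

definition highest :: "('n, 'b) crystal \<Rightarrow> 'b \<Rightarrow> bool" where
  "highest C b \<longleftrightarrow> b \<in> elts C \<and> (\<forall>i. eop C i b = None)"

definition component :: "('n, 'b) crystal \<Rightarrow> 'b \<Rightarrow> 'b set" where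
  "component C b =
     {b'. (b, b') \<in> {(x, y). x \<in> elts C \<and> (\<exists>i. eop C i x = Some y \<or> fop C i x = Some y)}\<^sup>*}"

definition morphism :: "('n, 'b) crystal \<Rightarrow> ('n, 'c) crystal \<Rightarrow> ('b \<Rightarrow> 'c option) \<Rightarrow> bool" where
  "morphism C D f \<longleftrightarrow> (\<forall>b\<in>elts C.
     (\<forall>c. f b = Some c \<longrightarrow> c \<in> elts D \<and> wt D c = wt C b)
   \<and> (\<forall>i. Option.bind (f b) (eop D i) = Option.bind (eop C i b) f)
   \<and> (\<forall>i. Option.bind (f b) (fop D i) = Option.bind (fop C i b) f))"

definition crystal_iso :: "('n, 'b) crystal \<Rightarrow> ('n, 'c) crystal \<Rightarrow> bool" where
  "crystal_iso C D \<longleftrightarrow> (\<exists>g. bij_betw g (elts C) (elts D) \<and> morphism C D (\<lambda>b. Some (g b)))"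

definition tensor :: "('n, 'b) crystal \<Rightarrow> ('n, 'c) crystal \<Rightarrow> ('n, 'b \<times> 'c) crystal" where
  "tensor B C = \<lparr>
     elts = elts B \<times> elts C,
     wt = (\<lambda>(b, c). wt B b + wt C c),
     eop = (\<lambda>i (b, c). if phi B i b \<ge> eps C i c
              then map_option (\<lambda>b'. (b', c)) (eop B i b)
              else map_option (\<lambda>c'. (b, c')) (eop C i c)),
     fop = (\<lambda>i (b, c). if phi B i b > eps C i c
              then map_option (\<lambda>b'. (b', c)) (fop B i b)
              else map_option (\<lambda>c'. (b, c')) (fop C i c))\<rparr>"

definition direct_sum :: "('n, 'b) crystal list \<Rightarrow> ('n, nat \<times> 'b) crystal" where
  "direct_sum Cs = \<lparr>
     elts = {(k, b). k < length Cs \<and> b \<in> elts (Cs ! k)},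
     wt = (\<lambda>(k, b). wt (Cs ! k) b),
     eop = (\<lambda>i (k, b). map_option (Pair k) (eop (Cs ! k) i b)),
     fop = (\<lambda>i (k, b). map_option (Pair k) (fop (Cs ! k) i b))\<rparr>"


section \<open>The crystal of a simple module\<close>

text \<open>The crystal is Kashiwara's crystal base at \<open>q = 0\<close> of the simple module over the quantized
  enveloping algebra over the field of rational functions in \<open>q\<close> with rational coefficients.
  A finite-dimensional module is realized on a subspace of the space of sequences.\<close>

type_synonym ratfun = "rat poly fract"
type_synonym qvec = "nat \<Rightarrow> ratfun"

definition qq :: ratfun where
  "qq = Fract [:0, 1:] 1"

definition regular :: "ratfun set" where
  "regular = {Fract a b | a b. poly b 0 \<noteq> 0}"

definition qscale :: "ratfun \<Rightarrow> qvec \<Rightarrow> qvec" where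
  "qscale c v = (\<lambda>k. c * v k)"

text \<open>\<open>d i\<close> is half the square length of \<open>\<alpha> i\<close>, with short roots having square length \<open>2\<close>.\<close>
definition symmetrizer :: "('n \<Rightarrow> 'n \<Rightarrow> int) \<Rightarrow> ('n \<Rightarrow> nat) \<Rightarrow> bool" where
  "symmetrizer A d \<longleftrightarrow> (\<forall>i. 0 < d i) \<and> (\<forall>i j. int (d i) * A i j = int (d j) * A j i)
     \<and> Gcd (range d) = 1"

definition qnum :: "nat \<Rightarrow> nat \<Rightarrow> ratfun" where
  "qnum m k = ((qq ^ m) ^ k - inverse (qq ^ m) ^ k) / (qq ^ m - inverse (qq ^ m))"

definition qfact :: "nat \<Rightarrow> nat \<Rightarrow> ratfun" where
  "qfact m k = (\<Prod>l=1..k. qnum m l)"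

definition divpow :: "nat \<Rightarrow> (qvec \<Rightarrow> qvec) \<Rightarrow> nat \<Rightarrow> qvec \<Rightarrow> qvec" where
  "divpow m X k v = qscale (inverse (qfact m k)) ((X ^^ k) v)"

record 'n qmodule =
  vecs :: "qvec set"
  qE :: "'n \<Rightarrow> qvec \<Rightarrow> qvec"
  qF :: "'n \<Rightarrow> qvec \<Rightarrow> qvec"
  qK :: "'n \<Rightarrow> qvec \<Rightarrow> qvec"
  qKinv :: "'n \<Rightarrow> qvec \<Rightarrow> qvec"

definition qlinear_on :: "qvec set \<Rightarrow> (qvec \<Rightarrow> qvec) \<Rightarrow> bool" where
  "qlinear_on V X \<longleftrightarrow> (\<forall>v\<in>V. X v \<in> V) \<and> (\<forall>v\<in>V. \<forall>w\<in>V. X (v + w) = X v + X w)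
     \<and> (\<forall>c. \<forall>v\<in>V. X (qscale c v) = qscale c (X v))"

definition is_qmodule :: "('n \<Rightarrow> 'n \<Rightarrow> int) \<Rightarrow> ('n \<Rightarrow> nat) \<Rightarrow> 'n qmodule \<Rightarrow> bool" where
  "is_qmodule A d M \<longleftrightarrow>
     module.subspace qscale (vecs M)
   \<and> (\<exists>S. finite S \<and> module.span qscale S = vecs M)
   \<and> (\<forall>i. qlinear_on (vecs M) (qE M i) \<and> qlinear_on (vecs M) (qF M i)
         \<and> qlinear_on (vecs M) (qK M i) \<and> qlinear_on (vecs M) (qKinv M i))
   \<and> (\<forall>v\<in>vecs M. \<forall>i j.
        qK M i (qKinv M i v) = v \<and> qKinv M i (qK M i v) = v
      \<and> qK M i (qK M j v) = qK M j (qK M i v)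
      \<and> qK M i (qE M j v) = qscale ((qq ^ d i) powi A i j) (qE M j (qK M i v))
      \<and> qK M i (qF M j v) = qscale ((qq ^ d i) powi (- A i j)) (qF M j (qK M i v))
      \<and> qE M i (qF M j v) - qF M j (qE M i v) =
          (if i = j then qscale (inverse (qq ^ d i - inverse (qq ^ d i))) (qK M i v - qKinv M i v)
           else 0)
      \<and> (i \<noteq> j \<longrightarrow>
          (\<Sum>k\<le>nat (1 - A i j). qscale ((- 1) ^ k) (divpow (d i) (qE M i) k
             (qE M j (divpow (d i) (qE M i) (nat (1 - A i j) - k) v)))) = 0
        \<and> (\<Sum>k\<le>nat (1 - A i j). qscale ((- 1) ^ k) (divpow (d i) (qF M i) k
             (qF M j (divpow (d i) (qF M i) (nat (1 - A i j) - k) v)))) = 0))"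

definition is_simple :: "'n qmodule \<Rightarrow> bool" where
  "is_simple M \<longleftrightarrow> vecs M \<noteq> {0} \<and> (\<forall>W \<subseteq> vecs M.
     module.subspace qscale W \<longrightarrow>
     (\<forall>w\<in>W. \<forall>i. qE M i w \<in> W \<and> qF M i w \<in> W \<and> qK M i w \<in> W \<and> qKinv M i w \<in> W) \<longrightarrow>
     W = {0} \<or> W = vecs M)"

definition weight_space :: "('n \<Rightarrow> nat) \<Rightarrow> 'n qmodule \<Rightarrow> 'n weight \<Rightarrow> qvec set" where
  "weight_space d M \<mu> = {v\<in>vecs M. \<forall>i. qK M i v = qscale ((qq ^ d i) powi \<mu> i) v}"

text \<open>\<open>v = \<Sum>\<^sub>n F\<^sub>i\<^sup>(\<^sup>n\<^sup>) u\<^sub>n\<close> with \<open>u\<^sub>n\<close> of weight \<open>\<mu> + n\<alpha>\<^sub>i\<close> killed by \<open>E\<^sub>i\<close>, nonzero only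
  for \<open>n \<ge> -\<langle>\<mu>, \<alpha>\<^sub>i\<^sup>\<or>\<rangle>\<close>; the Kashiwara operators shift the exponent in this sum.\<close>
definition string_decomp ::
  "('n \<Rightarrow> 'n \<Rightarrow> int) \<Rightarrow> ('n \<Rightarrow> nat) \<Rightarrow> 'n qmodule \<Rightarrow> 'n \<Rightarrow> 'n weight \<Rightarrow> qvec \<Rightarrow>
     nat \<Rightarrow> (nat \<Rightarrow> qvec) \<Rightarrow> bool" where
  "string_decomp A d M i \<mu> v N u \<longleftrightarrow>
     (\<forall>n\<le>N. u n \<in> weight_space d M (\<lambda>j. \<mu> j + int n * root_weight A i j) \<and> qE M i (u n) = 0
        \<and> (u n \<noteq> 0 \<longrightarrow> - \<mu> i \<le> int n))
   \<and> v = (\<Sum>n\<le>N. divpow (d i) (qF M i) n (u n))"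

definition kashiwara_f ::
  "('n \<Rightarrow> 'n \<Rightarrow> int) \<Rightarrow> ('n \<Rightarrow> nat) \<Rightarrow> 'n qmodule \<Rightarrow> 'n \<Rightarrow> 'n weight \<Rightarrow> qvec \<Rightarrow> qvec \<Rightarrow> bool" where
  "kashiwara_f A d M i \<mu> v w \<longleftrightarrow> (\<exists>N u. string_decomp A d M i \<mu> v N u
     \<and> w = (\<Sum>n\<le>N. divpow (d i) (qF M i) (n + 1) (u n)))"

definition kashiwara_e ::
  "('n \<Rightarrow> 'n \<Rightarrow> int) \<Rightarrow> ('n \<Rightarrow> nat) \<Rightarrow> 'n qmodule \<Rightarrow> 'n \<Rightarrow> 'n weight \<Rightarrow> qvec \<Rightarrow> qvec \<Rightarrow> bool" where
  "kashiwara_e A d M i \<mu> v w \<longleftrightarrow> (\<exists>N u. string_decomp A d M i \<mu> v N u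
     \<and> w = (\<Sum>n=1..N. divpow (d i) (qF M i) (n - 1) (u n)))"

inductive_set kashiwara_vectors ::
  "('n \<Rightarrow> 'n \<Rightarrow> int) \<Rightarrow> ('n \<Rightarrow> nat) \<Rightarrow> 'n qmodule \<Rightarrow> 'n weight \<Rightarrow> qvec \<Rightarrow> ('n weight \<times> qvec) set"
  for A d M hw u where
    base: "(hw, u) \<in> kashiwara_vectors A d M hw u"
  | step: "(\<mu>, v) \<in> kashiwara_vectors A d M hw u \<Longrightarrow> kashiwara_f A d M i \<mu> v w \<Longrightarrow>
       (\<mu> - root_weight A i, w) \<in> kashiwara_vectors A d M hw u"

definition lattice ::
  "('n \<Rightarrow> 'n \<Rightarrow> int) \<Rightarrow> ('n \<Rightarrow> nat) \<Rightarrow> 'n qmodule \<Rightarrow> 'n weight \<Rightarrow> qvec \<Rightarrow> qvec set" where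
  "lattice A d M hw u = {(\<Sum>v\<in>S. qscale (c v) v) | S c. finite S
     \<and> S \<subseteq> snd ` kashiwara_vectors A d M hw u \<and> c ` S \<subseteq> regular}"

definition qlattice ::
  "('n \<Rightarrow> 'n \<Rightarrow> int) \<Rightarrow> ('n \<Rightarrow> nat) \<Rightarrow> 'n qmodule \<Rightarrow> 'n weight \<Rightarrow> qvec \<Rightarrow> qvec set" where
  "qlattice A d M hw u = qscale qq ` lattice A d M hw u"

definition residue_class ::
  "('n \<Rightarrow> 'n \<Rightarrow> int) \<Rightarrow> ('n \<Rightarrow> nat) \<Rightarrow> 'n qmodule \<Rightarrow> 'n weight \<Rightarrow> qvec \<Rightarrow> qvec \<Rightarrow> qvec set" where
  "residue_class A d M hw u v = {v + w | w. w \<in> qlattice A d M hw u}"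

text \<open>The operator on the quotient of the lattice by \<open>q\<close> times it, induced by a Kashiwara
  operator; a weight vector of the quotient is stored as a pair of its weight and the residue
  class, and \<open>\<nu>\<close> is the weight of the result.\<close>
definition residue_op ::
  "('n \<Rightarrow> 'n \<Rightarrow> int) \<Rightarrow> ('n \<Rightarrow> nat) \<Rightarrow> 'n qmodule \<Rightarrow> 'n weight \<Rightarrow> qvec \<Rightarrow>
     (qvec \<Rightarrow> qvec \<Rightarrow> bool) \<Rightarrow> 'n weight \<Rightarrow> qvec set \<Rightarrow> ('n weight \<times> qvec set) option" where
  "residue_op A d M hw u R \<nu> X =
     (let w = (SOME w. \<exists>v\<in>X \<inter> lattice A d M hw u. R v w) in
      if w \<in> qlattice A d M hw u then None else Some (\<nu>, residue_class A d M hw u w))"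

definition module_f ::
  "('n \<Rightarrow> 'n \<Rightarrow> int) \<Rightarrow> ('n \<Rightarrow> nat) \<Rightarrow> 'n qmodule \<Rightarrow> 'n weight \<Rightarrow> qvec \<Rightarrow>
     'n \<Rightarrow> 'n weight \<times> qvec set \<Rightarrow> ('n weight \<times> qvec set) option" where
  "module_f A d M hw u i = (\<lambda>(\<mu>, X).
     residue_op A d M hw u (kashiwara_f A d M i \<mu>) (\<mu> - root_weight A i) X)"

definition module_e ::
  "('n \<Rightarrow> 'n \<Rightarrow> int) \<Rightarrow> ('n \<Rightarrow> nat) \<Rightarrow> 'n qmodule \<Rightarrow> 'n weight \<Rightarrow> qvec \<Rightarrow>
     'n \<Rightarrow> 'n weight \<times> qvec set \<Rightarrow> ('n weight \<times> qvec set) option" where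
  "module_e A d M hw u i = (\<lambda>(\<mu>, X).
     residue_op A d M hw u (kashiwara_e A d M i \<mu>) (\<mu> + root_weight A i) X)"

inductive_set module_crystal_elts ::
  "('n \<Rightarrow> 'n \<Rightarrow> int) \<Rightarrow> ('n \<Rightarrow> nat) \<Rightarrow> 'n qmodule \<Rightarrow> 'n weight \<Rightarrow> qvec \<Rightarrow>
     ('n weight \<times> qvec set) set"
  for A d M hw u where
    base: "(hw, residue_class A d M hw u u) \<in> module_crystal_elts A d M hw u"
  | step: "x \<in> module_crystal_elts A d M hw u \<Longrightarrow> module_f A d M hw u i x = Some y \<Longrightarrow>
       y \<in> module_crystal_elts A d M hw u"

definition module_crystal ::
  "('n \<Rightarrow> 'n \<Rightarrow> int) \<Rightarrow> ('n \<Rightarrow> nat) \<Rightarrow> 'n qmodule \<Rightarrow> 'n weight \<Rightarrow> qvec \<Rightarrow>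
     ('n, 'n weight \<times> qvec set) crystal" where
  "module_crystal A d M hw u = \<lparr>
     elts = module_crystal_elts A d M hw u,
     wt = fst,
     eop = module_e A d M hw u,
     fop = module_f A d M hw u\<rparr>"

definition simple_module_crystal ::
  "('n \<Rightarrow> 'n \<Rightarrow> int) \<Rightarrow> 'n weight \<Rightarrow> ('n, 'b) crystal \<Rightarrow> bool" where
  "simple_module_crystal A hw C \<longleftrightarrow> is_crystal A C \<and> (\<exists>d M u.
     symmetrizer A d \<and> is_qmodule A d M \<and> is_simple M
   \<and> u \<noteq> 0 \<and> u \<in> weight_space d M hw \<and> (\<forall>i. qE M i u = 0)
   \<and> crystal_iso C (module_crystal A d M hw u))"


section \<open>The category of crystals\<close>

text \<open>From here on \<open>B \<mu>\<close> stands for the crystal of the simple module of highest weight \<open>\<mu>\<close>.\<close>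

definition gcrys_object :: "('n weight \<Rightarrow> ('n, 'b) crystal) \<Rightarrow> ('n, 'c) crystal \<Rightarrow> bool" where
  "gcrys_object B C \<longleftrightarrow>
     (\<exists>\<mu>s. (\<forall>\<mu>\<in>set \<mu>s. dominant \<mu>) \<and> crystal_iso C (direct_sum (map B \<mu>s)))"

text \<open>The linear extension of a partial map: vectors in the span of the elements of a crystal
  are given by their coordinates, and the basis vector of \<open>x\<close> goes to that of \<open>f x\<close> or to \<open>0\<close>.\<close>
definition lin :: "('n, 'b) crystal \<Rightarrow> ('b \<Rightarrow> 'c option) \<Rightarrow> ('b \<Rightarrow> 'k::field) \<Rightarrow> ('c \<Rightarrow> 'k)" where
  "lin C f = (\<lambda>v y. \<Sum>x\<in>{x\<in>elts C. f x = Some y}. v x)"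

definition map_scale :: "'k::field \<Rightarrow> (('b \<Rightarrow> 'k) \<Rightarrow> ('c \<Rightarrow> 'k)) \<Rightarrow> ('b \<Rightarrow> 'k) \<Rightarrow> ('c \<Rightarrow> 'k)" where
  "map_scale a T = (\<lambda>v y. a * T v y)"

definition gcrys_hom ::
  "('n, 'b) crystal \<Rightarrow> ('n, 'c) crystal \<Rightarrow> (('b \<Rightarrow> 'k::field) \<Rightarrow> ('c \<Rightarrow> 'k)) set" where
  "gcrys_hom C D = module.span map_scale {lin C f | f. morphism C D f}"


section \<open>Tensor words\<close>

text \<open>Elements \<open>b\<^sub>1 \<otimes> \<dots> \<otimes> b\<^sub>m\<close> of a tensor word are stored as lists, which makes the tensor product
  strictly associative and unital.\<close>

definition unit_crystal :: "('n, 'b list) crystal" where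
  "unit_crystal = \<lparr>elts = {[]}, wt = (\<lambda>_. 0), eop = (\<lambda>_ _. None), fop = (\<lambda>_ _. None)\<rparr>"

definition cons_crystal :: "('n, 'b \<times> 'b list) crystal \<Rightarrow> ('n, 'b list) crystal" where
  "cons_crystal C = \<lparr>
     elts = (\<lambda>(b, bs). b # bs) ` elts C,
     wt = (\<lambda>x. wt C (hd x, tl x)),
     eop = (\<lambda>i x. map_option (\<lambda>(b, bs). b # bs) (eop C i (hd x, tl x))),
     fop = (\<lambda>i x. map_option (\<lambda>(b, bs). b # bs) (fop C i (hd x, tl x)))\<rparr>"

primrec word_crystal ::
  "('n weight \<Rightarrow> ('n, 'b) crystal) \<Rightarrow> 'n list \<Rightarrow> ('n, 'b list) crystal" where
  "word_crystal B [] = unit_crystal"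
| "word_crystal B (i # w) = cons_crystal (tensor (B (fund_weight i)) (word_crystal B w))"

definition word_weight :: "'n list \<Rightarrow> 'n weight" where
  "word_weight w = (\<Sum>i\<leftarrow>w. fund_weight i)"

definition word_highest :: "('n weight \<Rightarrow> ('n, 'b) crystal) \<Rightarrow> 'n list \<Rightarrow> 'b list" where
  "word_highest B w =
     (THE x. highest (word_crystal B w) x \<and> wt (word_crystal B w) x = word_weight w)"

definition comp_map :: "('b \<Rightarrow> 'c option) \<Rightarrow> ('a \<Rightarrow> 'b option) \<Rightarrow> 'a \<Rightarrow> 'c option"
    (infixr \<open>\<circ>\<^sub>0\<close> 55) where
  "g \<circ>\<^sub>0 f = (\<lambda>x. Option.bind (f x) g)"

text \<open>\<open>f \<otimes> g\<close>, where the domain of \<open>f\<close> is a tensor word of length \<open>m\<close>.\<close>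
definition tensor_map ::
  "nat \<Rightarrow> ('b list \<Rightarrow> 'b list option) \<Rightarrow> ('b list \<Rightarrow> 'b list option) \<Rightarrow> 'b list \<Rightarrow> 'b list option"
  where
  "tensor_map m f g x = Option.bind (f (take m x)) (\<lambda>y. map_option (\<lambda>z. y @ z) (g (drop m x)))"

definition flip :: "('n, 'b) crystal \<Rightarrow> ('b \<Rightarrow> 'c option) \<Rightarrow> 'c \<Rightarrow> 'b option" where
  "flip C f y = (if \<exists>x\<in>elts C. f x = Some y then Some (THE x. x \<in> elts C \<and> f x = Some y) else None)"


section \<open>Atoms\<close>

definition power_word :: "('n::{finite,linorder} \<Rightarrow> nat) \<Rightarrow> 'n list" where
  "power_word m = concat (map (\<lambda>i. replicate (m i) i) (sorted_list_of_set UNIV))"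

definition eps_word ::
  "('n::{finite,linorder} weight \<Rightarrow> ('n, 'b) crystal) \<Rightarrow> 'n \<Rightarrow> 'b \<Rightarrow> 'n list" where
  "eps_word B k b = power_word (\<lambda>i. eps (B (fund_weight k)) i b)"

definition phi_word ::
  "('n::{finite,linorder} weight \<Rightarrow> ('n, 'b) crystal) \<Rightarrow> 'n \<Rightarrow> 'b \<Rightarrow> 'n list" where
  "phi_word B k b = power_word (\<lambda>i. phi (B (fund_weight k)) i b)"

definition is_atom ::
  "('n::{finite,linorder} weight \<Rightarrow> ('n, 'b) crystal) \<Rightarrow> 'n \<Rightarrow> 'b \<Rightarrow>
     ('b list \<Rightarrow> 'b list option) \<Rightarrow> bool" where
  "is_atom B k b f \<longleftrightarrow>
     (let S = word_crystal B (eps_word B k b @ [k]);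
          T = word_crystal B (phi_word B k b);
          X = component S (word_highest B (eps_word B k b) @ [b]);
          Y = component T (word_highest B (phi_word B k b))
      in morphism S T f \<and> f ` X = Some ` Y \<and> (\<forall>x. x \<notin> X \<longrightarrow> f x = None))"

definition atom ::
  "('n::{finite,linorder} weight \<Rightarrow> ('n, 'b) crystal) \<Rightarrow> 'n \<Rightarrow> 'b \<Rightarrow> 'b list \<Rightarrow> 'b list option" where
  "atom B k b = (THE f. is_atom B k b f)"


section \<open>Crossings and permutations\<close>

type_synonym ('n, 'b) crossings = "'n \<Rightarrow> 'n \<Rightarrow> 'b list \<Rightarrow> 'b list option"

definition is_crossings ::
  "('n weight \<Rightarrow> ('n, 'b) crystal) \<Rightarrow> ('n, 'b) crossings \<Rightarrow> bool" where
  "is_crossings B \<beta> \<longleftrightarrow> (\<forall>i j. i \<noteq> j \<longrightarrow>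
     morphism (word_crystal B [i, j]) (word_crystal B [j, i]) (\<beta> i j)
   \<and> (\<forall>x\<in>elts (word_crystal B [i, j]). (\<beta> j i \<circ>\<^sub>0 \<beta> i j) x = Some x))"

text \<open>A composite of crossings is given by the list of the positions at which neighbouring strands
  are crossed, the first crossing to be applied coming first.\<close>

definition swap_at :: "nat \<Rightarrow> 'a list \<Rightarrow> 'a list" where
  "swap_at p w = w[p := w ! Suc p, Suc p := w ! p]"

fun crossing_target :: "'a list \<Rightarrow> nat list \<Rightarrow> 'a list" where
  "crossing_target w [] = w"
| "crossing_target w (p # ps) = crossing_target (swap_at p w) ps"

fun crossing_map ::
  "('n, 'b) crossings \<Rightarrow> 'n list \<Rightarrow> nat list \<Rightarrow> 'b list \<Rightarrow> 'b list option" where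
  "crossing_map \<beta> w [] = Some"
| "crossing_map \<beta> w (p # ps) = crossing_map \<beta> (swap_at p w) ps
     \<circ>\<^sub>0 tensor_map p Some (tensor_map 2 (\<beta> (w ! p) (w ! Suc p)) Some)"

text \<open>The pairs of strands that are crossed, in order.  Strands are named by their position in
  the domain; the state lists the strands at their current positions.\<close>
fun crossing_log :: "nat list \<Rightarrow> nat list \<Rightarrow> (nat \<times> nat) list" where
  "crossing_log s [] = []"
| "crossing_log s (p # ps) = (s ! p, s ! Suc p) # crossing_log (swap_at p s) ps"

text \<open>The last clause: strands \<open>x < y < z\<close> labelled \<open>i, j, k\<close> that are completely reversed cross in the
  order of \<open>(\<beta>\<^sub>j\<^sub>k \<otimes> id) (id \<otimes> \<beta>\<^sub>i\<^sub>k) (\<beta>\<^sub>i\<^sub>j \<otimes> id)\<close>, possibly with other crossings in between.\<close>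
definition is_permutation :: "'n list \<Rightarrow> nat list \<Rightarrow> 'n list \<Rightarrow> bool" where
  "is_permutation w ps w' \<longleftrightarrow>
     (let L = crossing_log [0..<length w] ps in
      (\<forall>p\<in>set ps. Suc p < length w) \<and> crossing_target w ps = w'
    \<and> (\<forall>(x, y)\<in>set L. w ! x \<noteq> w ! y)
    \<and> distinct (map (\<lambda>(x, y). {x, y}) L)
    \<and> (\<forall>x y z. x < y \<and> y < z \<and> (x, y) \<in> set L \<and> (x, z) \<in> set L \<and> (y, z) \<in> set L \<longrightarrow>
         (\<exists>a b c. a < b \<and> b < c \<and> c < length L
            \<and> L ! a = (x, y) \<and> L ! b = (x, z) \<and> L ! c = (y, z))))"

definition is_minimal_permutation :: "'n list \<Rightarrow> 'n list \<Rightarrow> nat list \<Rightarrow> 'n list \<Rightarrow> bool" where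
  "is_minimal_permutation w v ps w0 \<longleftrightarrow> is_permutation w ps (w0 @ v)
     \<and> (\<forall>ps' w0'. is_permutation w ps' (w0' @ v) \<longrightarrow> length ps \<le> length ps')"


section \<open>Distinguished bottom diagrams\<close>

text \<open>A diagram is a pair of its codomain word and the underlying map.  A diagram system assigns
  to a word and a highest weight element of its crystal the diagram of the component of that
  element; it records the chosen minimal permutations.\<close>

type_synonym ('n, 'b) diagram = "'n list \<times> ('b list \<Rightarrow> 'b list option)"

definition extend_diagram ::
  "('n::{finite,linorder} weight \<Rightarrow> ('n, 'b) crystal) \<Rightarrow> ('n, 'b) crossings \<Rightarrow> 'n list \<Rightarrow> 'n \<Rightarrow> 'b \<Rightarrow>
     ('n, 'b) diagram \<Rightarrow> nat list \<Rightarrow> 'n list \<Rightarrow> ('n, 'b) diagram" where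
  "extend_diagram B \<beta> w k b D' ps w0 =
     (w0 @ phi_word B k b,
      tensor_map (length w0) Some (atom B k b)
        \<circ>\<^sub>0 tensor_map (length w) (crossing_map \<beta> (fst D') ps \<circ>\<^sub>0 snd D') Some)"

definition is_diagram_system ::
  "('n::{finite,linorder} weight \<Rightarrow> ('n, 'b) crystal) \<Rightarrow> ('n, 'b) crossings \<Rightarrow>
     ('n list \<Rightarrow> 'b list \<Rightarrow> ('n, 'b) diagram) \<Rightarrow> bool" where
  "is_diagram_system B \<beta> D \<longleftrightarrow> D [] [] = ([], Some)
     \<and> (\<forall>w k h b. highest (word_crystal B (w @ [k])) (h @ [b]) \<longrightarrow>
          (\<exists>ps w0. is_minimal_permutation (fst (D w h)) (eps_word B k b) ps w0
             \<and> D (w @ [k]) (h @ [b]) = extend_diagram B \<beta> w k b (D w h) ps w0))"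

definition diagrams ::
  "('n weight \<Rightarrow> ('n, 'b) crystal) \<Rightarrow> ('n list \<Rightarrow> 'b list \<Rightarrow> ('n, 'b) diagram) \<Rightarrow> 'n list \<Rightarrow>
     'n weight \<Rightarrow> ('n, 'b) diagram set" where
  "diagrams B D w \<mu> = {d \<in> D w ` {h. highest (word_crystal B w) h}. word_weight (fst d) = \<mu>}"

end

theory Submission
  imports Defs
begin

text \<open>Let \<open>g\<close> be the diagram attached to the component of a highest weight element \<open>h\<close>.  By induction on
  the word, \<open>g\<close> is a morphism that is injective outside its kernel and sends \<open>h\<close> to the top element
  of its codomain.  It need not vanish on other components, but since the top weight has
  multiplicity one it can only send their highest weight elements to \<open>0\<close> or to elements of strictly
  lower weight.  Hence the morphism built from the diagrams of \<open>h\<close> and \<open>h'\<close> sends \<open>h\<close> to \<open>h'\<close>, and any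
  other highest weight element that it does not kill has lower weight than \<open>h\<close>.  A linear combination
  of morphisms is determined by its matrix entries at pairs of highest weight elements of equal
  weight, and on these entries the morphisms above are unitriangular.\<close>

section \<open>Crystals\<close>

text \<open>Semisimplicity is combinatorial here: peeling off one letter at a time and decomposing
  with \<open>monoidal\<close> covers every tensor word by copies of crystals
  \<open>B \<nu>\<close>. This makes a component determined by its highest weight element, makes the
  description that defines an atom have exactly one solution, and lets values at highest weight
  elements spread along lowering paths. The top weight having multiplicity one also controls the
  permutations: the image of a top element is forced by its weight, whatever crossings were chosen.
  Multiplicity one and triangularity both need the root order to be antisymmetric. This is read off
  from one crystal, that of the weight with all coordinates 1, by averaging weights over it. Pairs
  are ranked by their first entry \<open>h\<close> alone. Two pairs with the same \<open>h\<close>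
  are separated exactly, because the morphism of a pair has a single value at \<open>h\<close>,
  namely \<open>h'\<close>.\<close>

lemma Max_iter_eqI:
  assumes "x \<in> S"
    and "\<And>x. x \<in> S \<Longrightarrow> g x = None \<Longrightarrow> E x = 0"
    and "\<And>x y. x \<in> S \<Longrightarrow> g x = Some y \<Longrightarrow> y \<in> S \<and> E x = Suc (E y)"
  shows "Max {m. iter g m x \<noteq> None} = E x"
proof -
  have Suc: "iter g (Suc m) x = Option.bind (g x) (iter g m)" for m x
    by (induction m) (simp_all add: iter_def)
  have "x \<in> S \<Longrightarrow> iter g m x \<noteq> None \<longleftrightarrow> m \<le> E x" for m x
  proof (induction m arbitrary: x)
    case 0
    then show ?case by (simp add: iter_def)
  next
    case (Suc m)
    then show ?case
      using assms(2,3)[of x] by (cases "g x") (auto simp: \<open>\<And>m x. iter g (Suc m) x = _ m x\<close>)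
  qed
  \<comment> \<open>The exponents form an initial segment, so the set is finite and
    \<open>Max\<close>, unspecified on infinite sets, returns its end.\<close>
  then have "{m. iter g m x \<noteq> None} = {..E x}" using assms(1) by auto
  moreover have "Max {..E x} = E x" by (intro Max_eqI) auto
  ultimately show ?thesis by simp
qed

text \<open>One step along the string shifts the exponents by one and leaves the exponent 0 in
  addition. Finiteness is assumed because \<open>Max\<close> says nothing about infinite sets; in a
  crystal it comes from \<open>crys_string_finite\<close>.\<close>

lemma Max_iter_Some:
  assumes fin: "finite {m. iter g m x \<noteq> None}" and "g x = Some y"
  shows "Max {m. iter g m x \<noteq> None} = Suc (Max {m. iter g m y \<noteq> None})"
proof -
  have Suc: "iter g (Suc m) x = iter g m y" for m
    by (induction m) (simp_all add: iter_def assms(2))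
  have "n \<in> {m. iter g m x \<noteq> None} \<longleftrightarrow> n \<in> insert 0 (Suc ` {m. iter g m y \<noteq> None})" for n
    using Suc by (cases n) (auto simp: iter_def)
  then have eq: "{m. iter g m x \<noteq> None} = insert 0 (Suc ` {m. iter g m y \<noteq> None})"
    by blast
  then have "finite {m. iter g m y \<noteq> None}" using fin by (simp add: finite_image_iff)
  moreover have "{m. iter g m y \<noteq> None} \<noteq> {}" by (auto simp: iter_def intro: exI[of _ 0])
  ultimately show ?thesis
    unfolding eq by (subst Max_insert)
      (simp_all del: not_None_eq Collect_empty_eq add: mono_Max_commute[OF mono_Suc, symmetric])
qed

text \<open>The diagonal condition is bundled in because it makes the weight move strictly along an
  \<open>i\<close>-string. This excludes cyclic strings, on which \<open>eps\<close> and
  \<open>phi\<close> would be \<open>Max\<close> of an infinite set.\<close>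

definition crys :: "('n \<Rightarrow> 'n \<Rightarrow> int) \<Rightarrow> ('n, 'b) crystal \<Rightarrow> bool" where
  "crys A C \<longleftrightarrow> (\<forall>i. A i i = 2) \<and> is_crystal A C"

lemma crys_finite: "crys A C \<Longrightarrow> finite (elts C)"
  by (simp add: crys_def is_crystal_def)

lemma crys_e:
  "crys A C \<Longrightarrow> b \<in> elts C \<Longrightarrow> eop C i b = Some b' \<Longrightarrow>
    b' \<in> elts C \<and> wt C b' = wt C b + root_weight A i \<and> fop C i b' = Some b"
  unfolding crys_def is_crystal_def by blast

lemma crys_f:
  "crys A C \<Longrightarrow> b \<in> elts C \<Longrightarrow> fop C i b = Some b' \<Longrightarrow>
    b' \<in> elts C \<and> wt C b' = wt C b - root_weight A i \<and> eop C i b' = Some b"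
  unfolding crys_def is_crystal_def by blast

lemma crys_phi: "crys A C \<Longrightarrow> b \<in> elts C \<Longrightarrow> int (phi C i b) = wt C b i + int (eps C i b)"
  unfolding crys_def is_crystal_def by (metis diff_eq_eq)

text \<open>The \<open>i\<close>-th coordinate of the weight changes by 2 at each step, so the
  iterates are distinct elements of a finite set. The sign \<open>s\<close> treats raising and
  lowering at once.\<close>

lemma crys_string_finite_aux:
  assumes "crys A C" "b \<in> elts C"
    and g: "g = eop C i \<and> s = (1::int) \<or> g = fop C i \<and> s = - 1"
  shows "finite {m. iter g m b \<noteq> None}"
proof -
  have *: "iter g m b = Some y \<Longrightarrow> y \<in> elts C \<and> wt C y i = wt C b i + s * 2 * int m" for m y
  proof (induction m arbitrary: y)
    case 0
    then show ?case using assms by (simp add: iter_def)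
  next
    case (Suc m)
    then obtain z where z: "iter g m b = Some z" "g z = Some y"
      by (auto simp: iter_def bind_eq_Some_conv)
    moreover have "root_weight A i i = 2" using assms(1) by (simp add: crys_def root_weight_def)
    moreover have "z \<in> elts C" using Suc.IH[OF z(1)] by simp
    ultimately have "y \<in> elts C \<and> wt C y i = wt C z i + s * 2"
      using g crys_e[OF assms(1), of z i y] crys_f[OF assms(1), of z i y] by auto
    then show ?case using Suc.IH[OF z(1)] by (simp add: algebra_simps)
  qed
  have "inj_on (\<lambda>m. the (iter g m b)) {m. iter g m b \<noteq> None}"
  proof (rule inj_onI)
    fix m m' assume "m \<in> {m. iter g m b \<noteq> None}" "m' \<in> {m. iter g m b \<noteq> None}"
      "the (iter g m b) = the (iter g m' b)"
    then obtain y where "iter g m b = Some y" "iter g m' b = Some y" by auto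
    with *[of m y] *[of m' y] g show "m = m'" by auto
  qed
  moreover have "(\<lambda>m. the (iter g m b)) ` {m. iter g m b \<noteq> None} \<subseteq> elts C"
    using * by auto
  ultimately show ?thesis
    using crys_finite[OF assms(1)] inj_on_finite by blast
qed

lemma crys_string_finite:
  assumes "crys A C" "b \<in> elts C"
  shows "finite {m. iter (eop C i) m b \<noteq> None}" "finite {m. iter (fop C i) m b \<noteq> None}"
  using crys_string_finite_aux[OF assms, of "eop C i" i 1]
    crys_string_finite_aux[OF assms, of "fop C i" i "-1"] by blast+

lemma eps_None: "eop C i b = None \<Longrightarrow> eps C i b = 0"
  unfolding eps_def by (rule Max_iter_eqI[where S = "{b}" and E = "\<lambda>_. 0"]) auto

lemma phi_None: "fop C i b = None \<Longrightarrow> phi C i b = 0"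
  unfolding phi_def by (rule Max_iter_eqI[where S = "{b}" and E = "\<lambda>_. 0"]) auto

lemma eps_Some:
  "crys A C \<Longrightarrow> b \<in> elts C \<Longrightarrow> eop C i b = Some b' \<Longrightarrow> eps C i b = Suc (eps C i b')"
  unfolding eps_def by (rule Max_iter_Some[OF crys_string_finite(1)])

lemma phi_Some:
  "crys A C \<Longrightarrow> b \<in> elts C \<Longrightarrow> fop C i b = Some b' \<Longrightarrow> phi C i b = Suc (phi C i b')"
  unfolding phi_def by (rule Max_iter_Some[OF crys_string_finite(2)])

lemma eps_eq_0_iff: "crys A C \<Longrightarrow> b \<in> elts C \<Longrightarrow> eps C i b = 0 \<longleftrightarrow> eop C i b = None"
  by (cases "eop C i b") (simp_all add: eps_None eps_Some)

lemma phi_eq_0_iff: "crys A C \<Longrightarrow> b \<in> elts C \<Longrightarrow> phi C i b = 0 \<longleftrightarrow> fop C i b = None"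
  by (cases "fop C i b") (simp_all add: phi_None phi_Some)

lemma crys_e_phi:
  "crys A C \<Longrightarrow> b \<in> elts C \<Longrightarrow> eop C i b = Some b' \<Longrightarrow> phi C i b' = Suc (phi C i b)"
  using crys_e[of A C b i b'] phi_Some[of A C b' i b] by simp

lemma crys_f_eps:
  "crys A C \<Longrightarrow> b \<in> elts C \<Longrightarrow> fop C i b = Some b' \<Longrightarrow> eps C i b' = Suc (eps C i b)"
  using crys_f[of A C b i b'] eps_Some[of A C b' i b] by simp

lemma eps_eqI:
  assumes "x \<in> S"
    and "\<And>x. x \<in> S \<Longrightarrow> eop C i x = None \<Longrightarrow> E x = 0"
    and "\<And>x y. x \<in> S \<Longrightarrow> eop C i x = Some y \<Longrightarrow> y \<in> S \<and> E x = Suc (E y)"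
  shows "eps C i x = E x"
  unfolding eps_def using assms by (rule Max_iter_eqI)

lemma phi_eqI:
  assumes "x \<in> S"
    and "\<And>x. x \<in> S \<Longrightarrow> fop C i x = None \<Longrightarrow> E x = 0"
    and "\<And>x y. x \<in> S \<Longrightarrow> fop C i x = Some y \<Longrightarrow> y \<in> S \<and> E x = Suc (E y)"
  shows "phi C i x = E x"
  unfolding phi_def using assms by (rule Max_iter_eqI)

text \<open>The weight rule for \<open>fop\<close> follows from that for \<open>eop\<close> because
  the operators are partial inverses, so constructions check it only once.\<close>

lemma crysI:
  assumes "\<And>i. A i i = 2" "finite (elts C)"
    and "\<And>b i b'. b \<in> elts C \<Longrightarrow> eop C i b = Some b' \<Longrightarrow>
      b' \<in> elts C \<and> wt C b' = wt C b + root_weight A i \<and> fop C i b' = Some b"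
    and "\<And>b i b'. b \<in> elts C \<Longrightarrow> fop C i b = Some b' \<Longrightarrow>
      b' \<in> elts C \<and> eop C i b' = Some b"
    and "\<And>b i. b \<in> elts C \<Longrightarrow> int (phi C i b) = wt C b i + int (eps C i b)"
  shows "crys A C"
proof -
  have "wt C b' = wt C b - root_weight A i" if "b \<in> elts C" "fop C i b = Some b'" for b i b'
    using assms(3)[of b' i b] assms(4)[OF that] by simp
  moreover have "eop C i b = Some b' \<longleftrightarrow> fop C i b' = Some b"
    if "b \<in> elts C" "b' \<in> elts C" for b b' i
    using assms(3)[of b i b'] assms(4)[of b' i b] that by blast
  moreover have "int (phi C i b) - int (eps C i b) = wt C b i" if "b \<in> elts C" for b i
    using assms(5)[OF that, of i] by simp
  ultimately show ?thesis unfolding crys_def is_crystal_def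
    using assms(1-4) by (intro conjI ballI allI impI) blast+
qed

section \<open>Tensor products and their string lengths\<close>

lemma tensor_sel [simp]:
  "elts (tensor B C) = elts B \<times> elts C"
  "wt (tensor B C) (b, c) = wt B b + wt C c"
  "eop (tensor B C) i (b, c) = (if eps C i c \<le> phi B i b
              then map_option (\<lambda>b'. (b', c)) (eop B i b)
              else map_option (\<lambda>c'. (b, c')) (eop C i c))"
  "fop (tensor B C) i (b, c) = (if eps C i c < phi B i b
              then map_option (\<lambda>b'. (b', c)) (fop B i b)
              else map_option (\<lambda>c'. (b, c')) (fop C i c))"
  by (auto simp: tensor_def)

text \<open>Subtraction of naturals is truncated, so this is the usual maximum of
  \<open>eps B i b\<close> and \<open>eps B i b + eps C i c - phi B i b\<close>. The formula drops
  by one at each raising step and is 0 where raising stops.\<close>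

lemma eps_tensor:
  assumes B: "crys A B" and C: "crys A C" and "b \<in> elts B" "c \<in> elts C"
  shows "eps (tensor B C) i (b, c) = eps B i b + (eps C i c - phi B i b)"
proof -
  have "eps (tensor B C) i (b, c) = (\<lambda>(b, c). eps B i b + (eps C i c - phi B i b)) (b, c)"
  proof (rule eps_eqI[where S = "elts B \<times> elts C"])
    fix x assume "x \<in> elts B \<times> elts C" "eop (tensor B C) i x = None"
    then show "(\<lambda>(b, c). eps B i b + (eps C i c - phi B i b)) x = 0"
      using eps_None[of B i] eps_None[of C i] by (auto split: if_splits)
  next
    fix x y assume "x \<in> elts B \<times> elts C" "eop (tensor B C) i x = Some y"
    then show "y \<in> elts B \<times> elts C \<and> (\<lambda>(b, c). eps B i b + (eps C i c - phi B i b)) x =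
         Suc ((\<lambda>(b, c). eps B i b + (eps C i c - phi B i b)) y)"
      using eps_Some[OF B] eps_Some[OF C] crys_e_phi[OF B] crys_e[OF B] crys_e[OF C]
      by (fastforce split: if_splits)
  qed (use assms in auto)
  then show ?thesis by simp
qed

lemma phi_tensor:
  assumes B: "crys A B" and C: "crys A C" and "b \<in> elts B" "c \<in> elts C"
  shows "phi (tensor B C) i (b, c) = phi C i c + (phi B i b - eps C i c)"
proof -
  have "phi (tensor B C) i (b, c) = (\<lambda>(b, c). phi C i c + (phi B i b - eps C i c)) (b, c)"
  proof (rule phi_eqI[where S = "elts B \<times> elts C"])
    fix x assume "x \<in> elts B \<times> elts C" "fop (tensor B C) i x = None"
    then show "(\<lambda>(b, c). phi C i c + (phi B i b - eps C i c)) x = 0"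
      using phi_None[of B i] phi_None[of C i] by (auto split: if_splits)
  next
    fix x y assume "x \<in> elts B \<times> elts C" "fop (tensor B C) i x = Some y"
    then show "y \<in> elts B \<times> elts C \<and> (\<lambda>(b, c). phi C i c + (phi B i b - eps C i c)) x =
         Suc ((\<lambda>(b, c). phi C i c + (phi B i b - eps C i c)) y)"
      using phi_Some[OF B] phi_Some[OF C] crys_f_eps[OF C] crys_f[OF B] crys_f[OF C]
      by (fastforce split: if_splits)
  qed (use assms in auto)
  then show ?thesis by simp
qed

text \<open>Raising the left factor increases its \<open>phi\<close>, raising the right one
  decreases its \<open>eps\<close>. The non-strict test for \<open>eop\<close> therefore turns into
  the strict test for \<open>fop\<close> on the result, which selects the same factor again.\<close>

lemma crys_tensor:
  assumes B: "crys A B" and C: "crys A C"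
  shows "crys A (tensor B C)"
proof (rule crysI)
  fix x i y assume "x \<in> elts (tensor B C)" "eop (tensor B C) i x = Some y"
  then show "y \<in> elts (tensor B C) \<and> wt (tensor B C) y = wt (tensor B C) x + root_weight A i
     \<and> fop (tensor B C) i y = Some x"
    using crys_e[OF B] crys_e[OF C] crys_e_phi[OF B] eps_Some[OF C]
    by (fastforce split: if_splits simp: algebra_simps)
next
  fix x i y assume "x \<in> elts (tensor B C)" "fop (tensor B C) i x = Some y"
  then show "y \<in> elts (tensor B C) \<and> eop (tensor B C) i y = Some x"
    using crys_f[OF B] crys_f[OF C] crys_f_eps[OF C] phi_Some[OF B]
    by (fastforce split: if_splits)
next
  fix x i assume "x \<in> elts (tensor B C)"
  then show "int (phi (tensor B C) i x) = wt (tensor B C) x i + int (eps (tensor B C) i x)"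
    using crys_phi[OF B, of "fst x" i] crys_phi[OF C, of "snd x" i]
    by (cases x) (auto simp: eps_tensor[OF B C] phi_tensor[OF B C])
qed (use B crys_finite[OF B] crys_finite[OF C] in \<open>auto simp: crys_def\<close>)

lemma crys_unit: "(\<And>i. A i i = 2) \<Longrightarrow> crys A unit_crystal"
  by (rule crysI) (auto simp: unit_crystal_def eps_None phi_None)

lemma cons_crystal_sel [simp]:
  "elts (cons_crystal C) = (\<lambda>(b, bs). b # bs) ` elts C"
  "wt (cons_crystal C) (b # x) = wt C (b, x)"
  "eop (cons_crystal C) i (b # x) = map_option (\<lambda>(b, bs). b # bs) (eop C i (b, x))"
  "fop (cons_crystal C) i (b # x) = map_option (\<lambda>(b, bs). b # bs) (fop C i (b, x))"
  by (auto simp: cons_crystal_def)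

lemma eps_cons:
  assumes "crys A C" "(b, x) \<in> elts C"
  shows "eps (cons_crystal C) i (b # x) = eps C i (b, x)"
proof -
  have "eps (cons_crystal C) i (b # x) = (\<lambda>z. eps C i (hd z, tl z)) (b # x)"
  proof (rule eps_eqI[where S = "elts (cons_crystal C)"])
    show "b # x \<in> elts (cons_crystal C)" using assms(2) by force
  qed (use crys_e[OF assms(1)] in \<open>force simp: eps_None eps_Some[OF assms(1)]\<close>)+
  then show ?thesis by simp
qed

lemma phi_cons:
  assumes "crys A C" "(b, x) \<in> elts C"
  shows "phi (cons_crystal C) i (b # x) = phi C i (b, x)"
proof -
  have "phi (cons_crystal C) i (b # x) = (\<lambda>z. phi C i (hd z, tl z)) (b # x)"
  proof (rule phi_eqI[where S = "elts (cons_crystal C)"])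
    show "b # x \<in> elts (cons_crystal C)" using assms(2) by force
  qed (use crys_f[OF assms(1)] in \<open>force simp: phi_None phi_Some[OF assms(1)]\<close>)+
  then show ?thesis by simp
qed

lemma crys_cons:
  assumes C: "crys A C"
  shows "crys A (cons_crystal C)"
proof (rule crysI)
  fix x i y assume "x \<in> elts (cons_crystal C)" "eop (cons_crystal C) i x = Some y"
  then show "y \<in> elts (cons_crystal C) \<and> wt (cons_crystal C) y = wt (cons_crystal C) x + root_weight A i
     \<and> fop (cons_crystal C) i y = Some x"
    using crys_e[OF C] by fastforce
next
  fix x i y assume "x \<in> elts (cons_crystal C)" "fop (cons_crystal C) i x = Some y"
  then show "y \<in> elts (cons_crystal C) \<and> eop (cons_crystal C) i y = Some x"
    using crys_f[OF C] by fastforce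
next
  fix x i assume "x \<in> elts (cons_crystal C)"
  then show "int (phi (cons_crystal C) i x) = wt (cons_crystal C) x i + int (eps (cons_crystal C) i x)"
    using crys_phi[OF C] by (auto simp: eps_cons[OF C] phi_cons[OF C])
qed (use C crys_finite[OF C] in \<open>auto simp: crys_def\<close>)

section \<open>Morphisms\<close>

lemma morphismD:
  assumes "morphism C D f" "b \<in> elts C"
  shows morphism_elts: "f b = Some c \<Longrightarrow> c \<in> elts D"
    and morphism_wt: "f b = Some c \<Longrightarrow> wt D c = wt C b"
    and morphism_e: "Option.bind (f b) (eop D i) = Option.bind (eop C i b) f"
    and morphism_f: "Option.bind (f b) (fop D i) = Option.bind (fop C i b) f"
  using assms unfolding morphism_def by auto

text \<open>Second part: lowering \<open>b'\<close> gives back \<open>b\<close>, so killing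
  \<open>b'\<close> would kill \<open>b\<close>. With \<open>morphism_f_Some\<close> this says that
  a morphism vanishes on a whole component or nowhere on it.\<close>

lemma morphism_e_Some:
  assumes "crys A C" "morphism C D f" "b \<in> elts C" "f b = Some c" 
  shows "eop D i c = Option.bind (eop C i b) f" "eop C i b = Some b' \<Longrightarrow> f b' \<noteq> None"
proof -
  show "eop D i c = Option.bind (eop C i b) f"
    using morphism_e[OF assms(2,3), of i] assms(4) by simp
  assume "eop C i b = Some b'"
  then have "b' \<in> elts C" "fop C i b' = Some b" using crys_e[OF assms(1,3)] by auto
  then show "f b' \<noteq> None" using morphism_f[OF assms(2), of b' i] assms(4) by (cases "f b'") auto
qed

lemma morphism_f_Some:
  assumes "crys A C" "morphism C D f" "b \<in> elts C" "f b = Some c" 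
  shows "fop D i c = Option.bind (fop C i b) f" "fop C i b = Some b' \<Longrightarrow> f b' \<noteq> None"
proof -
  show "fop D i c = Option.bind (fop C i b) f"
    using morphism_f[OF assms(2,3), of i] assms(4) by simp
  assume "fop C i b = Some b'"
  then have "b' \<in> elts C" "eop C i b' = Some b" using crys_f[OF assms(1,3)] by auto
  then show "f b' \<noteq> None" using morphism_e[OF assms(2), of b' i] assms(4) by (cases "f b'") auto
qed

text \<open>Nothing on the string above \<open>b\<close> is killed, and by commutation the string of
  the image stops at the same place.\<close>

lemma morphism_eps:
  assumes "crys A C" "crys A D" "morphism C D f" "b \<in> elts C" "f b = Some c"
  shows "eps D i c = eps C i b"
  using assms(4,5)
proof (induction "eps C i b" arbitrary: b c)
  case 0
  then have "eop C i b = None" using eps_eq_0_iff[OF assms(1)] by metis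
  then show ?case using 0 morphism_e_Some(1)[OF assms(1,3) 0(2,3), of i] by (simp add: eps_None)
next
  case (Suc n)
  then obtain b' where b': "eop C i b = Some b'" using eps_None[of C i b] by fastforce
  then obtain c' where c': "f b' = Some c'" using morphism_e_Some(2)[OF assms(1,3) Suc(3,4)] by blast
  have "eop D i c = Some c'" using morphism_e_Some(1)[OF assms(1,3) Suc(3,4), of i] b' c' by simp
  moreover have "c \<in> elts D" using morphism_elts[OF assms(3) Suc(3,4)] .
  moreover have "b' \<in> elts C" using crys_e[OF assms(1) Suc(3) b'] by simp
  ultimately show ?case
    using Suc.hyps(1)[of b' c'] eps_Some[OF assms(1) Suc(3) b'] eps_Some[OF assms(2)] Suc(2) c' by simp
qed

lemma morphism_phi:
  assumes "crys A C" "crys A D" "morphism C D f" "b \<in> elts C" "f b = Some c"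
  shows "phi D i c = phi C i b"
  using morphism_eps[OF assms, of i] crys_phi[OF assms(1,4), of i] morphism_wt[OF assms(3,4,5)]
    crys_phi[OF assms(2) morphism_elts[OF assms(3,4,5)], of i] by simp

lemma morphism_highest:
  assumes "morphism C D f" "highest C b" "f b = Some c"
  shows "highest D c"
  unfolding highest_def
proof (intro conjI allI)
  have b: "b \<in> elts C" using assms(2) by (simp add: highest_def)
  show "c \<in> elts D" by (rule morphism_elts[OF assms(1) b assms(3)])
  show "eop D i c = None" for i
    using morphism_e[OF assms(1) b, of i] assms(2,3) by (simp add: highest_def)
qed

lemma morphism_comp:
  assumes f: "morphism C D f" and g: "morphism D E g"
  shows "morphism C E (g \<circ>\<^sub>0 f)"
  unfolding morphism_def
proof (intro ballI conjI allI impI)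
  fix b c i assume b: "b \<in> elts C"
  { assume "(g \<circ>\<^sub>0 f) b = Some c"
    then obtain d where "f b = Some d" "g d = Some c" by (auto simp: comp_map_def bind_eq_Some_conv)
    with morphism_elts[OF f b] morphism_wt[OF f b] morphism_elts[OF g] morphism_wt[OF g]
    show "c \<in> elts E" "wt E c = wt C b" by auto }
  have comm: "Option.bind ((g \<circ>\<^sub>0 f) b) p = Option.bind r (g \<circ>\<^sub>0 f)"
    if "Option.bind (f b) q = Option.bind r f"
      and "\<And>d. d \<in> elts D \<Longrightarrow> Option.bind (g d) p = Option.bind (q d) g" for p q r
  proof (cases "f b")
    case None
    then show ?thesis using that(1) by (cases r) (auto simp: comp_map_def)
  next
    case (Some d)
    then have "Option.bind (g d) p = Option.bind (Option.bind r f) g"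
      using that morphism_elts[OF f b] by simp
    then show ?thesis using Some by (simp add: comp_map_def)
  qed
  show "Option.bind ((g \<circ>\<^sub>0 f) b) (eop E i) = Option.bind (eop C i b) (g \<circ>\<^sub>0 f)"
    by (rule comm[OF morphism_e[OF f b] morphism_e[OF g]])
  show "Option.bind ((g \<circ>\<^sub>0 f) b) (fop E i) = Option.bind (fop C i b) (g \<circ>\<^sub>0 f)"
    by (rule comm[OF morphism_f[OF f b] morphism_f[OF g]])
qed

section \<open>Maps injective outside their kernel, and their flips\<close>

definition pinj :: "('n, 'b) crystal \<Rightarrow> ('b \<Rightarrow> 'c option) \<Rightarrow> bool" where
  "pinj C f \<longleftrightarrow> (\<forall>x\<in>elts C. \<forall>x'\<in>elts C. \<forall>y. f x = Some y \<longrightarrow> f x' = Some y \<longrightarrow> x = x')"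

lemma pinjD: "pinj C f \<Longrightarrow> x \<in> elts C \<Longrightarrow> x' \<in> elts C \<Longrightarrow> f x = Some y \<Longrightarrow> f x' = Some y \<Longrightarrow> x = x'"
  unfolding pinj_def by blast

lemma morphism_id: "morphism C C Some"
  by (simp add: morphism_def)

lemma pinj_id: "pinj C Some"
  by (simp add: pinj_def)

lemma pinj_comp:
  assumes "morphism C D f" "pinj C f" "pinj D g"
  shows "pinj C (g \<circ>\<^sub>0 f)"
  unfolding pinj_def
proof (intro ballI allI impI)
  fix x x' y assume x: "x \<in> elts C" "x' \<in> elts C" "(g \<circ>\<^sub>0 f) x = Some y" "(g \<circ>\<^sub>0 f) x' = Some y"
  then obtain z z' where "f x = Some z" "g z = Some y" "f x' = Some z'" "g z' = Some y"
    by (auto simp: comp_map_def bind_eq_Some_conv)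
  then show "x = x'"
    using x pinjD[OF assms(2), of x x' z] pinjD[OF assms(3), of z z' y]
      morphism_elts[OF assms(1)] by simp
qed

lemma flip_Some:
  assumes "pinj C f"
  shows "flip C f y = Some x \<longleftrightarrow> x \<in> elts C \<and> f x = Some y"
proof (cases "\<exists>x\<in>elts C. f x = Some y")
  case True
  then obtain x0 where x0: "x0 \<in> elts C" "f x0 = Some y" by blast
  then have "(THE x. x \<in> elts C \<and> f x = Some y) = x0"
    using pinjD[OF assms] by (intro the_equality) auto
  then show ?thesis using True x0 pinjD[OF assms, of x0 x y] by (auto simp: flip_def)
qed (auto simp: flip_def)

lemma flip_None:
  "flip C f y = None \<longleftrightarrow> \<not> (\<exists>x\<in>elts C. f x = Some y)"
  by (auto simp: flip_def)

text \<open>The image of a morphism and its complement are both stable under the operators, so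
  inverting on the image and killing the rest commutes with them.\<close>

lemma morphism_flip:
  assumes C: "crys A C" and D: "crys A D" and f: "morphism C D f" and inj: "pinj C f"
  shows "morphism D C (flip C f)"
  unfolding morphism_def
proof (intro ballI conjI allI impI)
  fix y x i assume y: "y \<in> elts D"
  { assume "flip C f y = Some x"
    then show "x \<in> elts C" "wt C x = wt D y"
      using morphism_wt[OF f, of x y] by (auto simp: flip_Some[OF inj]) }
  show "Option.bind (flip C f y) (eop C i) = Option.bind (eop D i y) (flip C f)"
  proof (cases "flip C f y")
    case None
    \<comment> \<open>If \<open>y'\<close> had a preimage, lowering that preimage would produce one
      of \<open>y\<close>.\<close>
    have "flip C f y' = None" if y': "eop D i y = Some y'" for y'
    proof (rule ccontr)
      assume "flip C f y' \<noteq> None"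
      then obtain x where x: "x \<in> elts C" "f x = Some y'" by (auto simp: flip_Some[OF inj])
      have "fop D i y' = Some y" using crys_e[OF D y y'] by simp
      then show False using morphism_f_Some[OF C f x, of i] None x crys_f[OF C x(1), of i]
        by (auto simp: flip_None bind_eq_Some_conv)
    qed
    with None show ?thesis by (cases "eop D i y") auto
  next
    case (Some x)
    then have x: "x \<in> elts C" "f x = Some y" by (auto simp: flip_Some[OF inj])
    show ?thesis
    proof (cases "eop C i x")
      case None
      then show ?thesis using morphism_e_Some[OF C f x, of i] Some by simp
    next
      case (Some x')
      then obtain y' where "f x' = Some y'" "x' \<in> elts C"
        using morphism_e_Some(2)[OF C f x Some] crys_e[OF C x(1) Some] by auto
      then have "flip C f y' = Some x'" "eop D i y = Some y'"
        using morphism_e_Some(1)[OF C f x, of i] Some by (simp_all add: flip_Some[OF inj])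
      then show ?thesis using Some \<open>flip C f y = Some x\<close> by simp
    qed
  qed
  show "Option.bind (flip C f y) (fop C i) = Option.bind (fop D i y) (flip C f)"
  proof (cases "flip C f y")
    case None
    have "flip C f y' = None" if y': "fop D i y = Some y'" for y'
    proof (rule ccontr)
      assume "flip C f y' \<noteq> None"
      then obtain x where x: "x \<in> elts C" "f x = Some y'" by (auto simp: flip_Some[OF inj])
      have "eop D i y' = Some y" using crys_f[OF D y y'] by simp
      then show False using morphism_e_Some[OF C f x, of i] None x crys_e[OF C x(1), of i]
        by (auto simp: flip_None bind_eq_Some_conv)
    qed
    with None show ?thesis by (cases "fop D i y") auto
  next
    case (Some x)
    then have x: "x \<in> elts C" "f x = Some y" by (auto simp: flip_Some[OF inj])
    show ?thesis
    proof (cases "fop C i x")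
      case None
      then show ?thesis using morphism_f_Some[OF C f x, of i] Some by simp
    next
      case (Some x')
      then obtain y' where "f x' = Some y'" "x' \<in> elts C"
        using morphism_f_Some(2)[OF C f x Some] crys_f[OF C x(1) Some] by auto
      then have "flip C f y' = Some x'" "fop D i y = Some y'"
        using morphism_f_Some(1)[OF C f x, of i] Some by (simp_all add: flip_Some[OF inj])
      then show ?thesis using Some \<open>flip C f y = Some x\<close> by simp
    qed
  qed
qed

section \<open>Weights\<close>

text \<open>The root order: the columns of \<open>A\<close> are the simple roots in fundamental
  weight coordinates. For arbitrary \<open>A\<close> it is a preorder;
  \<open>independent_columns\<close> makes it antisymmetric.\<close>

definition weight_le :: "('n::finite \<Rightarrow> 'n \<Rightarrow> int) \<Rightarrow> 'n weight \<Rightarrow> 'n weight \<Rightarrow> bool" where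
  "weight_le A \<nu> \<mu> \<longleftrightarrow> (\<exists>n :: 'n \<Rightarrow> nat. \<mu> = \<nu> + (\<lambda>j. \<Sum>i\<in>UNIV. int (n i) * A j i))"

lemma weight_le_refl: "weight_le A \<mu> \<mu>"
  unfolding weight_le_def by (rule exI[of _ "\<lambda>_. 0"]) (simp add: fun_eq_iff)

lemma weight_le_add:
  assumes "weight_le A \<nu> \<mu>" "weight_le A \<nu>' \<mu>'"
  shows "weight_le A (\<nu> + \<nu>') (\<mu> + \<mu>')"
proof -
  obtain n m where "\<mu> = \<nu> + (\<lambda>j. \<Sum>i\<in>UNIV. int (n i) * A j i)"
    "\<mu>' = \<nu>' + (\<lambda>j. \<Sum>i\<in>UNIV. int (m i) * A j i)"
    using assms unfolding weight_le_def by auto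
  then show ?thesis unfolding weight_le_def
    by (intro exI[of _ "\<lambda>i. n i + m i"]) (auto simp: fun_eq_iff algebra_simps sum.distrib)
qed

lemma weight_le_trans:
  assumes "weight_le A \<nu> \<mu>" "weight_le A \<mu> \<kappa>"
  shows "weight_le A \<nu> \<kappa>"
proof -
  obtain n m where "\<mu> = \<nu> + (\<lambda>j. \<Sum>i\<in>UNIV. int (n i) * A j i)"
    "\<kappa> = \<mu> + (\<lambda>j. \<Sum>i\<in>UNIV. int (m i) * A j i)"
    using assms unfolding weight_le_def by auto
  then show ?thesis unfolding weight_le_def
    by (intro exI[of _ "\<lambda>i. n i + m i"]) (auto simp: fun_eq_iff algebra_simps sum.distrib)
qed

lemma weight_le_root: "weight_le A (\<mu> - root_weight A i) \<mu>"
proof -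
  have "(\<Sum>k\<in>UNIV. int (if k = i then 1 else 0) * A j k) = A j i" for j
    by (subst sum.remove[of _ i]) auto
  then show ?thesis unfolding weight_le_def root_weight_def
    by (intro exI[of _ "\<lambda>k. if k = i then 1 else 0"]) (simp add: fun_eq_iff)
qed

text \<open>Only relations with nonnegative coefficients are excluded. Antisymmetry asks for exactly
  this, since two opposite comparisons add up to such a relation.\<close>

definition independent_columns :: "('n::finite \<Rightarrow> 'n \<Rightarrow> int) \<Rightarrow> bool" where
  "independent_columns A \<longleftrightarrow>
     (\<forall>n :: 'n \<Rightarrow> nat. (\<forall>j. (\<Sum>i\<in>UNIV. int (n i) * A j i) = 0) \<longrightarrow> (\<forall>i. n i = 0))"

lemma weight_le_antisym:
  assumes "independent_columns A" "weight_le A \<nu> \<mu>" "weight_le A \<mu> \<nu>"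
  shows "\<nu> = \<mu>"
proof -
  obtain n m where n: "\<mu> = \<nu> + (\<lambda>j. \<Sum>i\<in>UNIV. int (n i) * A j i)"
    and m: "\<nu> = \<mu> + (\<lambda>j. \<Sum>i\<in>UNIV. int (m i) * A j i)"
    using assms(2,3) unfolding weight_le_def by blast
  have "(\<Sum>i\<in>UNIV. int (n i + m i) * A j i) = 0" for j
    using fun_cong[OF n, of j] fun_cong[OF m, of j] by (simp add: algebra_simps sum.distrib)
  then have "\<forall>i. n i + m i = 0"
    using assms(1)[unfolded independent_columns_def, rule_format, of "\<lambda>i. n i + m i"] by blast
  then show ?thesis using n by (simp add: fun_eq_iff)
qed

inductive lowered :: "('n, 'b) crystal \<Rightarrow> 'b \<Rightarrow> 'b \<Rightarrow> bool" for C h where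
  refl: "lowered C h h"
| step: "lowered C h x \<Longrightarrow> fop C i x = Some y \<Longrightarrow> lowered C h y"

lemma lowered_elts: "crys A C \<Longrightarrow> h \<in> elts C \<Longrightarrow> lowered C h x \<Longrightarrow> x \<in> elts C"
  by (rotate_tac 2, induction rule: lowered.induct) (auto dest: crys_f)

lemma lowered_wt:
  assumes "crys A C" "h \<in> elts C" "lowered C h x"
  shows "weight_le A (wt C x) (wt C h)"
  using assms(3)
proof (induction rule: lowered.induct)
  case refl
  show ?case by (rule weight_le_refl)
next
  case (step x i y)
  then show ?case
    using crys_f[OF assms(1) lowered_elts[OF assms(1,2) step(1)] step(2)]
      weight_le_trans[OF weight_le_root] by metis
qed

lemma sum_phi_eq_sum_eps:
  assumes C: "crys A C"
  shows "(\<Sum>b\<in>elts C. phi C i b) = (\<Sum>b\<in>elts C. eps C i b)"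
proof -
  \<comment> \<open>Raising pairs the elements with \<open>eps > 0\<close> with those with \<open>phi > 0\<close>;
    sum \<open>phi * (eps + 1)\<close> over the latter.\<close>
  have "(\<Sum>b\<in>elts C. (phi C i b + 1) * eps C i b)
      = (\<Sum>b\<in>{b\<in>elts C. eop C i b \<noteq> None}. (phi C i b + 1) * eps C i b)"
    by (rule sum.mono_neutral_right) (auto simp: crys_finite[OF C] eps_None)
  also have "\<dots> = (\<Sum>b\<in>{b\<in>elts C. fop C i b \<noteq> None}. phi C i b * (eps C i b + 1))"
    by (rule sum.reindex_bij_witness[where i = "\<lambda>b. the (fop C i b)" and j = "\<lambda>b. the (eop C i b)"])
      (auto dest: crys_e[OF C] crys_f[OF C] simp: crys_e_phi[OF C] eps_Some[OF C])
  also have "\<dots> = (\<Sum>b\<in>elts C. phi C i b * (eps C i b + 1))"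
    by (rule sum.mono_neutral_left) (auto simp: crys_finite[OF C] phi_None)
  \<comment> \<open>Expanding both products leaves the common sum of \<open>phi * eps\<close>, which
    cancels.\<close>
  finally show ?thesis by (simp add: algebra_simps sum.distrib)
qed

text \<open>Stands in for the Weyl group symmetry of the weights: raising and lowering balance over
  the whole crystal.\<close>

lemma sum_wt:
  assumes C: "crys A C"
  shows "(\<Sum>b\<in>elts C. wt C b i) = 0"
proof -
  have "(\<Sum>b\<in>elts C. wt C b i) = (\<Sum>b\<in>elts C. int (phi C i b) - int (eps C i b))"
    by (rule sum.cong) (auto simp: crys_phi[OF C])
  then show ?thesis
    using arg_cong[OF sum_phi_eq_sum_eps[OF C, of i], of int] by (simp add: sum_subtractf)
qed

text \<open>If a nonnegative combination of the columns vanished, the symmetrizer would turn it into a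
  combination of coroots that is constant on the weights of the crystal; but these weights sum to
  zero, while the value at \<open>h\<close> is positive.\<close>

lemma independent_columnsI:
  assumes C: "crys A C" and h: "h \<in> elts C" "\<And>i. 0 < wt C h i"
    and lowered: "\<And>x. x \<in> elts C \<Longrightarrow> lowered C h x"
    and d: "\<And>i. 0 < d i" "\<And>i j. int (d i) * A i j = int (d j) * A j i"
  shows "independent_columns A"
  unfolding independent_columns_def
proof (intro allI impI)
  fix n :: "'a \<Rightarrow> nat" and i
  assume n: "\<forall>j. (\<Sum>i\<in>UNIV. int (n i) * A j i) = 0"
  define K where "K = (\<lambda>\<mu> :: 'a weight. \<Sum>i\<in>UNIV. int (n i * d i) * \<mu> i)"
  have "K (\<mu> - root_weight A j) = K \<mu>" for \<mu> j
  proof -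
    have "K (\<mu> - root_weight A j) = K \<mu> - (\<Sum>i\<in>UNIV. int (n i * d i) * A i j)"
      by (simp add: K_def root_weight_def right_diff_distrib sum_subtractf)
    \<comment> \<open>Symmetry of \<open>d i * A i j\<close> turns the value of \<open>K\<close> at
      the \<open>j\<close>-th simple root into \<open>d j\<close> times the \<open>j\<close>-th
      coordinate of the vanishing combination.\<close>
    also have "(\<Sum>i\<in>UNIV. int (n i * d i) * A i j) = (\<Sum>i\<in>UNIV. int (d j) * (int (n i) * A j i))"
      using d(2)[of _ j] by (intro sum.cong) (auto simp: mult.assoc mult.left_commute)
    also have "\<dots> = 0" using n by (simp add: sum_distrib_left[symmetric])
    finally show ?thesis by linarith
  qed
  then have K_step: "wt C y = wt C x - root_weight A j \<Longrightarrow> K (wt C y) = K (wt C x)" for x y j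
    by metis
  have K: "K (wt C x) = K (wt C h)" if "lowered C h x" for x
    using that
  proof (induction rule: lowered.induct)
    case (step x i y)
    have "K (wt C y) = K (wt C x)"
      using crys_f[OF C lowered_elts[OF C h(1) step(1)] step(2)] by (intro K_step) blast
    then show ?case using step by simp
  qed simp
  have "int (card (elts C)) * K (wt C h) = (\<Sum>x\<in>elts C. K (wt C x))"
    using K lowered by simp
  also have "\<dots> = (\<Sum>i\<in>UNIV. int (n i * d i) * (\<Sum>x\<in>elts C. wt C x i))"
    unfolding K_def by (subst sum.swap) (simp add: sum_distrib_left)
  also have "\<dots> = 0" by (simp add: sum_wt[OF C])
  finally have "K (wt C h) = 0" using h(1) crys_finite[OF C] by auto
  then have "\<forall>i\<in>UNIV. int (n i * d i) * wt C h i = 0"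
    unfolding K_def using h(2) by (subst (asm) sum_nonneg_eq_0_iff) (auto simp: less_imp_le)
  then have "int (n i * d i) * wt C h i = 0" by blast
  then show "n i = 0" using h(2)[of i] d(1)[of i] by simp
qed

text \<open>Used for extremal weights: a sum can reach its bound only if each summand does. The
  mixed sum \<open>\<nu> + \<mu>'\<close> is sandwiched between the two equal sums.\<close>

lemma weight_le_add_eqD:
  assumes "weight_le A \<nu> \<mu>" "weight_le A \<nu>' \<mu>'" "\<nu> + \<nu>' = \<mu> + \<mu>'" "independent_columns A"
  shows "\<nu> = \<mu>" "\<nu>' = \<mu>'"
proof -
  have "weight_le A (\<nu> + \<mu>') (\<mu> + \<mu>')" "weight_le A (\<nu> + \<nu>') (\<nu> + \<mu>')"
    using weight_le_add[OF assms(1) weight_le_refl] weight_le_add[OF weight_le_refl assms(2)] by auto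
  then have "\<nu> + \<mu>' = \<mu> + \<mu>'" using weight_le_antisym[OF assms(4)] assms(3) by metis
  then show "\<nu> = \<mu>" by simp
  then show "\<nu>' = \<mu>'" using assms(3) by simp
qed

section \<open>Tensor words\<close>

lemma word_length: "x \<in> elts (word_crystal B w) \<Longrightarrow> length x = length w"
  by (induction w arbitrary: x) (auto simp: unit_crystal_def)

locale fund_crystals =
  fixes A :: "'n::{finite,linorder} \<Rightarrow> 'n \<Rightarrow> int" and B :: "'n weight \<Rightarrow> ('n, 'b) crystal"
  assumes crys_fund: "crys A (B (fund_weight i))"
begin

abbreviation W where "W \<equiv> word_crystal B"

lemma crys_word: "crys A (W w)"
proof (induction w)
  case Nil
  have "A i i = 2" for i using crys_fund[of i] unfolding crys_def by blast
  then show ?case by (simp add: crys_unit)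
qed (simp add: crys_cons crys_tensor crys_fund)

lemma word_Nil_sel [simp]: "elts (W []) = {[]}" "wt (W []) x = 0" "eop (W []) i x = None" "fop (W []) i x = None"
  "eps (W []) i x = 0" "phi (W []) i x = 0"
  by (simp_all add: unit_crystal_def eps_None phi_None zero_fun_def)

lemma word_Cons_sel:
  assumes "b \<in> elts (B (fund_weight k))" "x \<in> elts (W w)"
  shows "eps (W (k # w)) i (b # x) = eps (B (fund_weight k)) i b + (eps (W w) i x - phi (B (fund_weight k)) i b)"
    and "phi (W (k # w)) i (b # x) = phi (W w) i x + (phi (B (fund_weight k)) i b - eps (W w) i x)"
  using assms
  by (simp_all add: eps_cons[OF crys_tensor[OF crys_fund crys_word]]
      phi_cons[OF crys_tensor[OF crys_fund crys_word]] eps_tensor[OF crys_fund crys_word] phi_tensor[OF crys_fund crys_word])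

lemma word_singleton:
  assumes "b \<in> elts (B (fund_weight k))"
  shows "eps (W [k]) i [b] = eps (B (fund_weight k)) i b" "phi (W [k]) i [b] = phi (B (fund_weight k)) i b"
    "wt (W [k]) [b] = wt (B (fund_weight k)) b"
    "eop (W [k]) i [b] = map_option (\<lambda>b. [b]) (eop (B (fund_weight k)) i b)"
  using word_Cons_sel[OF assms, of "[]" "[]" i] by (simp_all del: word_crystal.simps(1) add: option.map_comp comp_def)

lemma elts_append: "elts (W (w @ v)) = (\<lambda>(x, y). x @ y) ` (elts (W w) \<times> elts (W v))"
proof (induction w)
  case (Cons k w)
  show ?case (is "_ = ?R")
  proof (intro set_eqI iffI)
    fix z assume "z \<in> elts (W ((k # w) @ v))"
    then obtain b x y where "z = b # x @ y" "b \<in> elts (B (fund_weight k))" "x \<in> elts (W w)" "y \<in> elts (W v)"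
      using Cons by auto
    then show "z \<in> ?R" by (intro image_eqI[of _ _ "(b # x, y)"]) auto
  next
    fix z assume "z \<in> ?R"
    then show "z \<in> elts (W ((k # w) @ v))" using Cons by force
  qed
qed (force simp del: word_crystal.simps(1))

lemma append_elts: "x \<in> elts (W w) \<Longrightarrow> y \<in> elts (W v) \<Longrightarrow> x @ y \<in> elts (W (w @ v))"
  by (force simp: elts_append)

text \<open>Associativity of the tensor product: a word cut at any place behaves like the product of
  its two parts. The formulas share one induction because the branch an operator takes on a cons
  depends on \<open>eps\<close> of the tail.\<close>

lemma append_sel:
  assumes "x \<in> elts (W w)" and y: "y \<in> elts (W v)"
  shows "wt (W (w @ v)) (x @ y) = wt (W w) x + wt (W v) y \<and>
    eps (W (w @ v)) i (x @ y) = eps (W w) i x + (eps (W v) i y - phi (W w) i x) \<and>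
    phi (W (w @ v)) i (x @ y) = phi (W v) i y + (phi (W w) i x - eps (W v) i y) \<and>
    eop (W (w @ v)) i (x @ y) = (if eps (W v) i y \<le> phi (W w) i x
       then map_option (\<lambda>x'. x' @ y) (eop (W w) i x) else map_option ((@) x) (eop (W v) i y)) \<and>
    fop (W (w @ v)) i (x @ y) = (if eps (W v) i y < phi (W w) i x
       then map_option (\<lambda>x'. x' @ y) (fop (W w) i x) else map_option ((@) x) (fop (W v) i y))"
  using assms(1)
proof (induction w arbitrary: x)
  case Nil
  then show ?case
    using eps_eq_0_iff[OF crys_word y, of i]
    by (cases "fop (W v) i y") (auto simp del: word_crystal.simps(1))
next
  case (Cons k w)
  then obtain b x' where x: "x = b # x'" "b \<in> elts (B (fund_weight k))" "x' \<in> elts (W w)" by auto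
  note IH = Cons.IH[OF x(3)]
  have xy: "x' @ y \<in> elts (W (w @ v))" by (rule append_elts[OF x(3) y])
  have "wt (W ((k # w) @ v)) (x @ y) = wt (W (k # w)) x + wt (W v) y"
    using IH x(1) by (simp add: fun_eq_iff)
  moreover have "eps (W ((k # w) @ v)) i (x @ y) = eps (W (k # w)) i x + (eps (W v) i y - phi (W (k # w)) i x)"
    using IH unfolding x(1) append_Cons word_Cons_sel[OF x(2,3)] word_Cons_sel[OF x(2) xy] by linarith
  moreover have "phi (W ((k # w) @ v)) i (x @ y) = phi (W v) i y + (phi (W (k # w)) i x - eps (W v) i y)"
    using IH unfolding x(1) append_Cons word_Cons_sel[OF x(2,3)] word_Cons_sel[OF x(2) xy] by linarith
  moreover have "eop (W ((k # w) @ v)) i (x @ y) = (if eps (W v) i y \<le> phi (W (k # w)) i x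
       then map_option (\<lambda>x'. x' @ y) (eop (W (k # w)) i x) else map_option ((@) x) (eop (W v) i y))"
    using IH unfolding x(1) append_Cons word_Cons_sel[OF x(2,3)]
    by (auto simp: option.map_comp comp_def)
  moreover have "fop (W ((k # w) @ v)) i (x @ y) = (if eps (W v) i y < phi (W (k # w)) i x
       then map_option (\<lambda>x'. x' @ y) (fop (W (k # w)) i x) else map_option ((@) x) (fop (W v) i y))"
    using IH unfolding x(1) append_Cons word_Cons_sel[OF x(2,3)]
    by (auto simp: option.map_comp comp_def)
  ultimately show ?case by blast
qed

lemmas append_wt = append_sel[THEN conjunct1]
lemmas append_eps = append_sel[THEN conjunct2, THEN conjunct1]
lemmas append_e = append_sel[THEN conjunct2, THEN conjunct2, THEN conjunct2, THEN conjunct1]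
lemmas append_f = append_sel[THEN conjunct2, THEN conjunct2, THEN conjunct2, THEN conjunct2]

text \<open>\<open>eps\<close> of the product is a sum of two naturals, so it vanishes only if both
  do. Hence prefixes of highest weight elements are highest, and \<open>eps\<close> of the next
  letter is bounded by \<open>phi\<close> of the prefix.\<close>

lemma highest_append:
  assumes "x \<in> elts (W w)" "y \<in> elts (W v)"
  shows "highest (W (w @ v)) (x @ y) \<longleftrightarrow> highest (W w) x \<and> (\<forall>i. eps (W v) i y \<le> phi (W w) i x)"
proof -
  have "eop (W (w @ v)) i (x @ y) = None \<longleftrightarrow> eop (W w) i x = None \<and> eps (W v) i y \<le> phi (W w) i x" for i
    using append_eps[OF assms, of i] eps_eq_0_iff[OF crys_word assms(1), of i]
      eps_eq_0_iff[OF crys_word append_elts[OF assms], of i] by auto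
  then show ?thesis using assms append_elts[OF assms] by (auto simp: highest_def)
qed

lemma tensor_map_append:
  "x \<in> elts (W w) \<Longrightarrow> tensor_map (length w) f g (x @ y) = Option.bind (f x) (\<lambda>x'. map_option ((@) x') (g y))"
  by (simp add: tensor_map_def word_length)

text \<open>Which factor an operator acts on is decided by \<open>phi\<close> and
  \<open>eps\<close>, which morphisms preserve where they are nonzero. A factor that is killed stays
  killed after an operator step, so in that case both sides are \<open>None\<close>.\<close>

lemma morphism_tensor_map:
  assumes f: "morphism (W w) (W w') f" and g: "morphism (W v) (W v') g"
  shows "morphism (W (w @ v)) (W (w' @ v')) (tensor_map (length w) f g)"
  unfolding morphism_def
proof (intro ballI conjI allI impI)
  fix z c i assume "z \<in> elts (W (w @ v))"
  then obtain x y where z: "z = x @ y" and x: "x \<in> elts (W w)" and y: "y \<in> elts (W v)"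
    by (auto simp: elts_append)
  let ?t = "tensor_map (length w) f g"
  { assume "?t z = Some c"
    then obtain x' y' where "f x = Some x'" "g y = Some y'" "c = x' @ y'"
      using z x by (auto simp: tensor_map_append bind_eq_Some_conv)
    then show "c \<in> elts (W (w' @ v'))" "wt (W (w' @ v')) c = wt (W (w @ v)) z"
      using z x y morphism_elts[OF f x] morphism_elts[OF g y] morphism_wt[OF f x] morphism_wt[OF g y]
      by (simp_all add: append_elts append_wt) }
  have e: "eop (W w) i x = Some x1 \<Longrightarrow> x1 \<in> elts (W w)" for x1
    using crys_e[OF crys_word x] by blast
  have f': "fop (W w) i x = Some x1 \<Longrightarrow> x1 \<in> elts (W w)" for x1
    using crys_f[OF crys_word x] by blast
  show "Option.bind (?t z) (eop (W (w' @ v')) i) = Option.bind (eop (W (w @ v)) i z) ?t"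
  proof (cases "f x = None \<or> g y = None")
    case True
    then have "?t z = None" using x z by (auto simp: tensor_map_append)
    moreover have "Option.bind (eop (W (w @ v)) i z) ?t = None"
      using True z morphism_e[OF f x, of i] morphism_e[OF g y, of i] e
      by (cases "eop (W w) i x"; cases "eop (W v) i y")
        (auto simp: append_e[OF x y] tensor_map_append x split: bind_splits)
    ultimately show ?thesis by simp
  next
    case False
    then obtain x' y' where xy: "f x = Some x'" "g y = Some y'" by auto
    then have "x' \<in> elts (W w')" "y' \<in> elts (W v')"
      using morphism_elts[OF f x] morphism_elts[OF g y] by auto
    moreover have "eps (W v') i y' = eps (W v) i y" "phi (W w') i x' = phi (W w) i x"
      using morphism_eps[OF crys_word crys_word g y xy(2)] morphism_phi[OF crys_word crys_word f x xy(1)] by auto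
    ultimately show ?thesis
      using xy z x e morphism_e_Some(1)[OF crys_word f x xy(1), of i] morphism_e_Some(1)[OF crys_word g y xy(2), of i]
      by (cases "eop (W w) i x"; cases "eop (W v) i y")
        (auto simp: append_e[OF x y] append_e tensor_map_append map_option_bind split: bind_splits)
  qed
  show "Option.bind (?t z) (fop (W (w' @ v')) i) = Option.bind (fop (W (w @ v)) i z) ?t"
  proof (cases "f x = None \<or> g y = None")
    case True
    then have "?t z = None" using x z by (auto simp: tensor_map_append)
    moreover have "Option.bind (fop (W (w @ v)) i z) ?t = None"
      using True z morphism_f[OF f x, of i] morphism_f[OF g y, of i] f'
      by (cases "fop (W w) i x"; cases "fop (W v) i y")
        (auto simp: append_f[OF x y] tensor_map_append x split: bind_splits)
    ultimately show ?thesis by simp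
  next
    case False
    then obtain x' y' where xy: "f x = Some x'" "g y = Some y'" by auto
    then have "x' \<in> elts (W w')" "y' \<in> elts (W v')"
      using morphism_elts[OF f x] morphism_elts[OF g y] by auto
    moreover have "eps (W v') i y' = eps (W v) i y" "phi (W w') i x' = phi (W w) i x"
      using morphism_eps[OF crys_word crys_word g y xy(2)] morphism_phi[OF crys_word crys_word f x xy(1)] by auto
    ultimately show ?thesis
      using xy z x f' morphism_f_Some(1)[OF crys_word f x xy(1), of i] morphism_f_Some(1)[OF crys_word g y xy(2), of i]
      by (cases "fop (W w) i x"; cases "fop (W v) i y")
        (auto simp: append_f[OF x y] append_f tensor_map_append map_option_bind split: bind_splits)
  qed
qed

lemma pinj_tensor_map:
  assumes "morphism (W w) (W w') f" "pinj (W w) f" "pinj (W v) g"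
  shows "pinj (W (w @ v)) (tensor_map (length w) f g)"
  unfolding pinj_def
proof (intro ballI allI impI)
  fix z1 z2 c
  assume "z1 \<in> elts (W (w @ v))" "z2 \<in> elts (W (w @ v))"
    and c: "tensor_map (length w) f g z1 = Some c" "tensor_map (length w) f g z2 = Some c"
  then obtain x1 y1 x2 y2 where z: "z1 = x1 @ y1" "z2 = x2 @ y2"
    and x: "x1 \<in> elts (W w)" "x2 \<in> elts (W w)" and y: "y1 \<in> elts (W v)" "y2 \<in> elts (W v)"
    by (auto simp: elts_append)
  with c obtain x1' y1' x2' y2' where f: "f x1 = Some x1'" "f x2 = Some x2'"
    and g: "g y1 = Some y1'" "g y2 = Some y2'" and eq: "c = x1' @ y1'" "c = x2' @ y2'"
    by (auto simp: tensor_map_append bind_eq_Some_conv)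
  \<comment> \<open>All images under \<open>f\<close> have the length of \<open>w'\<close>, so the
    concatenation splits uniquely.\<close>
  have "length x1' = length x2'"
    using word_length[OF morphism_elts[OF assms(1) x(1) f(1)]] word_length[OF morphism_elts[OF assms(1) x(2) f(2)]] by simp
  with eq have "x1' = x2'" "y1' = y2'" by auto
  then show "z1 = z2"
    using z f g pinjD[OF assms(2) x] pinjD[OF assms(3) y] by auto
qed

end

definition ptotal :: "('n, 'b) crystal \<Rightarrow> ('b \<Rightarrow> 'c option) \<Rightarrow> bool" where
  "ptotal C f \<longleftrightarrow> (\<forall>x\<in>elts C. f x \<noteq> None)"

lemma ptotal_Some: "ptotal C f \<Longrightarrow> x \<in> elts C \<Longrightarrow> \<exists>y. f x = Some y"
  by (auto simp: ptotal_def)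

lemma ptotal_comp: "morphism C D f \<Longrightarrow> ptotal C f \<Longrightarrow> ptotal D g \<Longrightarrow> ptotal C (g \<circ>\<^sub>0 f)"
  unfolding ptotal_def comp_map_def by (fastforce dest: morphism_elts)

lemma pinj_flip: "pinj C f \<Longrightarrow> pinj D (flip C f)"
  by (simp add: pinj_def[of D] flip_Some)

lemma (in fund_crystals) ptotal_tensor_map:
  "ptotal (W w) f \<Longrightarrow> ptotal (W v) g \<Longrightarrow> ptotal (W (w @ v)) (tensor_map (length w) f g)"
  by (fastforce simp: ptotal_def elts_append tensor_map_append)

lemma inverse_morphism:
  assumes C: "crys A C" and bij: "bij_betw h (elts C) (elts D)" and h: "morphism C D (\<lambda>b. Some (h b))"
  shows "morphism D C (\<lambda>y. Some (inv_into (elts C) h y))"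
  unfolding morphism_def
proof (intro ballI conjI allI impI)
  let ?h = "inv_into (elts C) h"
  fix y c i assume y: "y \<in> elts D"
  have x: "?h y \<in> elts C" and hx: "h (?h y) = y"
    using bij y by (auto simp: bij_betw_def inv_into_into f_inv_into_f)
  { assume "Some (?h y) = Some c"
    then show "c \<in> elts C" "wt C c = wt D y"
      using x hx morphism_wt[OF h x, of y] by auto }
  have inv: "?h (h z) = z" if "z \<in> elts C" for z
    using bij that by (simp add: bij_betw_def inv_into_f_f)
  show "Option.bind (Some (?h y)) (eop C i) = Option.bind (eop D i y) (\<lambda>y. Some (?h y))"
    using morphism_e[OF h x, of i] hx inv crys_e[OF C x, of i]
    by (cases "eop C i (?h y)") auto
  show "Option.bind (Some (?h y)) (fop C i) = Option.bind (fop D i y) (\<lambda>y. Some (?h y))"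
    using morphism_f[OF h x, of i] hx inv crys_f[OF C x, of i]
    by (cases "fop C i (?h y)") auto
qed

text \<open>The identity tensored with \<open>f\<close>, for a crystal \<open>C\<close> such as
  \<open>B \<nu>\<close> whose elements are not lists, so that \<open>morphism_tensor_map\<close>
  does not apply. The target is already in the list form of words.\<close>

lemma morphism_tensor_cons:
  assumes B: "crys A B" and C: "crys A C" and D: "crys A D" and f: "morphism C D f" "ptotal C f"
  shows "morphism (tensor B C) (cons_crystal (tensor B D)) (\<lambda>(b, c). map_option ((#) b) (f c))"
  unfolding morphism_def
proof (intro ballI conjI allI impI)
  let ?g = "\<lambda>(b, c). map_option ((#) b) (f c)"
  fix z d i assume "z \<in> elts (tensor B C)"
  then obtain b c where z: "z = (b, c)" "b \<in> elts B" "c \<in> elts C" by auto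
  obtain c' where c': "f c = Some c'" using ptotal_Some[OF f(2) z(3)] by blast
  have c'D: "c' \<in> elts D" using morphism_elts[OF f(1) z(3) c'] .
  { assume "?g z = Some d"
    then show "d \<in> elts (cons_crystal (tensor B D))" "wt (cons_crystal (tensor B D)) d = wt (tensor B C) z"
      using z c' c'D morphism_wt[OF f(1) z(3) c'] by auto }
  have [simp]: "eps D i c' = eps C i c"
    using morphism_eps[OF C D f(1) z(3) c'] .
  show "Option.bind (?g z) (eop (cons_crystal (tensor B D)) i) = Option.bind (eop (tensor B C) i z) ?g"
    using morphism_e[OF f(1) z(3), of i] z c'
    by (cases "eop B i b"; cases "eop C i c") (auto simp: map_option_case split: option.splits)
  show "Option.bind (?g z) (fop (cons_crystal (tensor B D)) i) = Option.bind (fop (tensor B C) i z) ?g"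
    using morphism_f[OF f(1) z(3), of i] z c'
    by (cases "fop B i b"; cases "fop C i c") (auto simp: map_option_case split: option.splits)
qed

section \<open>Components of tensor words\<close>

lemma dominant_fund: "dominant (fund_weight i)"
  by (simp add: dominant_def fund_weight_def)

text \<open>The interface between crystal bases and combinatorics. \<open>generated\<close> comes
  from building the crystal by lowering operators, \<open>indep\<close> from the crystal of the
  weight with all coordinates 1, and \<open>monoidal\<close> is closure of the category under tensor
  products.\<close>

locale crystal_family =
  fixes A :: "'n::{finite,linorder} \<Rightarrow> 'n \<Rightarrow> int" and B :: "'n weight \<Rightarrow> ('n, 'b) crystal"
    and u :: "'n weight \<Rightarrow> 'b"
  assumes crys: "dominant \<mu> \<Longrightarrow> crys A (B \<mu>)"
    and indep: "independent_columns A"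
    and u_elts: "dominant \<mu> \<Longrightarrow> u \<mu> \<in> elts (B \<mu>)"
    and u_wt: "dominant \<mu> \<Longrightarrow> wt (B \<mu>) (u \<mu>) = \<mu>"
    and generated: "dominant \<mu> \<Longrightarrow> x \<in> elts (B \<mu>) \<Longrightarrow> lowered (B \<mu>) (u \<mu>) x"
    and monoidal: "dominant \<mu> \<Longrightarrow> dominant \<nu> \<Longrightarrow> gcrys_object B (tensor (B \<mu>) (B \<nu>))"
begin

sublocale fund_crystals A B
  by unfold_locales (rule crys[OF dominant_fund])

lemma root_weight_nonzero: "root_weight A i \<noteq> 0"
proof
  assume "root_weight A i = 0"
  then have "root_weight A i i = 0" by simp
  moreover have "A i i = 2" using crys_fund[of i] unfolding crys_def by blast
  ultimately show False by (simp add: root_weight_def)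
qed

lemma not_raised_le: "\<not> weight_le A (\<mu> + root_weight A i) \<mu>"
proof
  assume "weight_le A (\<mu> + root_weight A i) \<mu>"
  moreover have "weight_le A \<mu> (\<mu> + root_weight A i)"
    using weight_le_root[of A "\<mu> + root_weight A i" i] by simp
  ultimately have "\<mu> + root_weight A i = \<mu>" by (rule weight_le_antisym[OF indep])
  then show False using root_weight_nonzero[of i] by (metis add_cancel_right_right)
qed

lemma highestI:
  assumes C: "crys A C" and "h \<in> elts C" "\<And>x. x \<in> elts C \<Longrightarrow> weight_le A (wt C x) (wt C h)"
  shows "highest C h"
  unfolding highest_def
proof (intro conjI allI)
  show "eop C i h = None" for i
  proof (rule ccontr)
    assume "eop C i h \<noteq> None"
    then obtain y where "eop C i h = Some y" by auto
    then have "weight_le A (wt C h + root_weight A i) (wt C h)"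
      using crys_e[OF C assms(2), of i y] assms(3) by metis
    then show False by (simp add: not_raised_le)
  qed
qed (rule assms(2))

lemma wt_le:
  assumes "dominant \<mu>" "x \<in> elts (B \<mu>)"
  shows "weight_le A (wt (B \<mu>) x) \<mu>"
  using lowered_wt[OF crys[OF assms(1)] u_elts[OF assms(1)] generated[OF assms]]
  by (simp add: u_wt[OF assms(1)])

lemma u_highest: "dominant \<mu> \<Longrightarrow> highest (B \<mu>) (u \<mu>)"
  by (rule highestI[OF crys u_elts]) (auto simp: u_wt wt_le)

text \<open>Every element other than \<open>u \<mu>\<close> arises by a lowering step and can
  therefore be raised again.\<close>

lemma highest_unique:
  assumes \<mu>: "dominant \<mu>" and x: "highest (B \<mu>) x"
  shows "x = u \<mu>"
proof -
  have "x \<in> elts (B \<mu>)" using x by (simp add: highest_def)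
  from generated[OF \<mu> this] show ?thesis
  proof cases
    case (step y i)
    then show ?thesis
      using crys_f[OF crys[OF \<mu>] lowered_elts[OF crys[OF \<mu>] u_elts[OF \<mu>] step(1)] step(2)] x
      by (simp add: highest_def)
  qed simp
qed

text \<open>Such an element has maximal weight, so it is highest: the highest weight has
  multiplicity one.\<close>

lemma wt_eq_imp_u:
  assumes \<mu>: "dominant \<mu>" and x: "x \<in> elts (B \<mu>)" "wt (B \<mu>) x = \<mu>"
  shows "x = u \<mu>"
  by (rule highest_unique[OF \<mu> highestI[OF crys[OF \<mu>] x(1)]]) (simp add: x wt_le \<mu>)

definition embeds :: "'n weight \<Rightarrow> ('b \<Rightarrow> 'c option) \<Rightarrow> ('n, 'c) crystal \<Rightarrow> bool" where
  "embeds \<nu> f C \<longleftrightarrow> dominant \<nu> \<and> morphism (B \<nu>) C f \<and> pinj (B \<nu>) f \<and> ptotal (B \<nu>) f"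

text \<open>At a highest weight element \<open>phi\<close> equals the weight coordinate, here 0, so
  nothing can be lowered. This identifies the empty word with the crystal of weight 0.\<close>

lemma trivial_crystal:
  assumes "\<And>i. \<mu> i = 0"
  shows "elts (B \<mu>) = {u \<mu>}" "fop (B \<mu>) i (u \<mu>) = None"
proof -
  have dom: "dominant \<mu>" using assms by (simp add: dominant_def)
  have f: "fop (B \<mu>) i (u \<mu>) = None" for i
    using crys_phi[OF crys[OF dom] u_elts[OF dom], of i] u_wt[OF dom] u_highest[OF dom] assms[of i]
    by (simp add: highest_def eps_None phi_eq_0_iff[OF crys[OF dom] u_elts[OF dom], symmetric])
  have "lowered (B \<mu>) (u \<mu>) x \<Longrightarrow> x = u \<mu>" for x
    by (induction rule: lowered.induct) (auto simp: f)
  then show "elts (B \<mu>) = {u \<mu>}" using generated[OF dom] u_elts[OF dom] by blast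
  show "fop (B \<mu>) i (u \<mu>) = None" by (rule f)
qed

text \<open>Complete reducibility of tensor words, element by element. After the first letter is
  peeled off, the rest lies in a copy of some \<open>B \<nu>\<close>, and \<open>monoidal\<close>
  decomposes the product of the letter's crystal with \<open>B \<nu>\<close>.\<close>

lemma word_embedding:
  assumes "x \<in> elts (W w)"
  shows "\<exists>\<nu> f b. embeds \<nu> f (W w) \<and> b \<in> elts (B \<nu>) \<and> f b = Some x"
  using assms
proof (induction w arbitrary: x)
  case Nil
  define \<mu> where "\<mu> = (\<lambda>_ :: 'n. 0 :: int)"
  have \<mu>0: "\<And>i. \<mu> i = 0" by (simp add: \<mu>_def)
  have dom: "dominant \<mu>" by (simp add: dominant_def \<mu>0)
  have "wt (B \<mu>) (u \<mu>) = (\<lambda>_. 0)" using u_wt[OF dom] by (simp add: \<mu>_def)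
  then have "embeds \<mu> (\<lambda>_. Some []) (W [])"
    using u_highest[OF dom] dom trivial_crystal[of \<mu>, OF \<mu>0]
    by (simp add: zero_fun_def embeds_def morphism_def pinj_def ptotal_def highest_def unit_crystal_def)
  then show ?case using Nil u_elts[OF dom] by (intro exI[of _ \<mu>] exI[of _ "\<lambda>_. Some []"]) (auto simp: unit_crystal_def)
next
  case (Cons k w)
  let ?K = "B (fund_weight k)"
  obtain b x' where x: "x = b # x'" "b \<in> elts ?K" "x' \<in> elts (W w)" using Cons.prems by auto
  obtain \<nu> f y where f: "embeds \<nu> f (W w)" and y: "y \<in> elts (B \<nu>)" "f y = Some x'"
    using Cons.IH[OF x(3)] by blast
  have dom: "dominant \<nu>" using f by (simp add: embeds_def)
  define T where "T = tensor ?K (B \<nu>)"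
  have T: "crys A T" unfolding T_def by (rule crys_tensor[OF crys_fund crys[OF dom]])
  obtain \<mu>s h where \<mu>s: "\<forall>\<mu>\<in>set \<mu>s. dominant \<mu>"
    and h: "bij_betw h (elts T) (elts (direct_sum (map B \<mu>s)))"
      "morphism T (direct_sum (map B \<mu>s)) (\<lambda>b. Some (h b))"
    using monoidal[OF dominant_fund[of k] dom] unfolding gcrys_object_def crystal_iso_def T_def
    by (elim exE conjE) 
  define h' where "h' = inv_into (elts T) h"
  have h': "morphism (direct_sum (map B \<mu>s)) T (\<lambda>y. Some (h' y))"
    unfolding h'_def by (rule inverse_morphism[OF T h])
  have byT: "(b, y) \<in> elts T" using x y by (simp add: T_def)
  then have "h (b, y) \<in> elts (direct_sum (map B \<mu>s))" using h(1) by (auto simp: bij_betw_def)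
  then obtain j z where jz: "h (b, y) = (j, z)" "j < length \<mu>s" "z \<in> elts (B (\<mu>s ! j))"
    by (auto simp: direct_sum_def)
  have "h' (j, z) = (b, y)" using h(1) byT jz(1) by (metis bij_betw_def h'_def inv_into_f_f)
  define \<kappa> where "\<kappa> = \<mu>s ! j"
  \<comment> \<open>The copy of \<open>B \<kappa>\<close> is reached through the \<open>j\<close>-th
    summand, the inverse of the decomposition, and the identity tensored with
    \<open>f\<close>.\<close>
  define i1 where "i1 = (\<lambda>z :: 'b. Some (j, z))"
  define i2 where "i2 = (\<lambda>y. Some (h' y))"
  define i3 where "i3 = (\<lambda>(b :: 'b, c). map_option ((#) b) (f c))"
  have m1: "morphism (B \<kappa>) (direct_sum (map B \<mu>s)) i1"
    using jz(2) crys_e[OF crys[of \<kappa>]] \<mu>s unfolding morphism_def i1_def \<kappa>_def direct_sum_def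
    by (auto simp: map_option_case split: option.splits)
  have m3: "morphism T (W (k # w)) i3"
    unfolding i3_def T_def word_crystal.simps(2)
    using f by (intro morphism_tensor_cons[OF crys_fund crys[OF dom] crys_word]) (auto simp: embeds_def)
  have "inj_on h' (elts (direct_sum (map B \<mu>s)))"
    using h(1) by (metis bij_betw_def h'_def inj_on_inv_into subset_refl)
  then have p: "pinj (B \<kappa>) i1" "pinj (direct_sum (map B \<mu>s)) i2" "pinj T i3"
    using f by (auto simp: pinj_def i1_def i2_def i3_def T_def embeds_def inj_on_def)
  have t: "ptotal (B \<kappa>) i1" "ptotal (direct_sum (map B \<mu>s)) i2" "ptotal T i3"
    using f by (auto simp: ptotal_def i1_def i2_def i3_def T_def embeds_def)
  note m2 = h'[folded i2_def]
  have "embeds \<kappa> (i3 \<circ>\<^sub>0 i2 \<circ>\<^sub>0 i1) (W (k # w))"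
    unfolding embeds_def
  proof (intro conjI)
    note m12 = morphism_comp[OF m1 m2]
    show "dominant \<kappa>" using \<mu>s jz(2) by (simp add: \<kappa>_def)
    show "morphism (B \<kappa>) (W (k # w)) (i3 \<circ>\<^sub>0 i2 \<circ>\<^sub>0 i1)" by (rule morphism_comp[OF m12 m3])
    show "pinj (B \<kappa>) (i3 \<circ>\<^sub>0 i2 \<circ>\<^sub>0 i1)"
      by (rule pinj_comp[OF m12 pinj_comp[OF m1 p(1,2)] p(3)])
    show "ptotal (B \<kappa>) (i3 \<circ>\<^sub>0 i2 \<circ>\<^sub>0 i1)"
      by (rule ptotal_comp[OF m12 ptotal_comp[OF m1 t(1,2)] t(3)])
  qed
  moreover have "(i3 \<circ>\<^sub>0 i2 \<circ>\<^sub>0 i1) z = Some x"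
    using \<open>h' (j, z) = (b, y)\<close> y x by (simp add: comp_map_def i1_def i2_def i3_def)
  ultimately show ?case using jz(3) unfolding \<kappa>_def by blast
qed

text \<open>In a copy containing \<open>h\<close> the preimage of \<open>h\<close> cannot be raised,
  so it is the generator; comparing weights then determines which crystal was embedded.\<close>

lemma highest_embedding:
  assumes h: "highest (W w) h"
  obtains f where "embeds (wt (W w) h) f (W w)" "f (u (wt (W w) h)) = Some h"
proof -
  have "h \<in> elts (W w)" using h by (simp add: highest_def)
  from word_embedding[OF this] obtain \<nu> f b
    where f: "embeds \<nu> f (W w)" "b \<in> elts (B \<nu>)" "f b = Some h" by (elim exE conjE)
  then have \<nu>: "dominant \<nu>" and m: "morphism (B \<nu>) (W w) f" by (auto simp: embeds_def)
  have "eop (B \<nu>) i b = None" for i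
    using morphism_e_Some[OF crys[OF \<nu>] m f(2,3), of i] h
    by (cases "eop (B \<nu>) i b") (auto simp: highest_def)
  then have "highest (B \<nu>) b" using f(2) by (simp add: highest_def)
  then have "b = u \<nu>" by (rule highest_unique[OF \<nu>])
  moreover have "\<nu> = wt (W w) h" using morphism_wt[OF m f(2,3)] u_wt[OF \<nu>] \<open>b = u \<nu>\<close> by simp
  ultimately show ?thesis using that[of f] f by simp
qed

lemma embedding_lowered:
  assumes f: "embeds \<nu> f (W w)" and b: "b \<in> elts (B \<nu>)"
  shows "\<exists>h y. f (u \<nu>) = Some h \<and> f b = Some y \<and> lowered (W w) h y"
proof -
  have \<nu>: "dominant \<nu>" and m: "morphism (B \<nu>) (W w) f" and t: "ptotal (B \<nu>) f"
    using f by (auto simp: embeds_def)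
  from ptotal_Some[OF t u_elts[OF \<nu>]] obtain h where h: "f (u \<nu>) = Some h" by (elim exE)
  from generated[OF \<nu> b] have "\<exists>y. f b = Some y \<and> lowered (W w) h y"
  proof (induction rule: lowered.induct)
    case refl
    then show ?case using h lowered.refl[of "W w" h] by simp
  next
    case (step x i y)
    then obtain x' where x': "f x = Some x'" "lowered (W w) h x'" by blast
    have x: "x \<in> elts (B \<nu>)" by (rule lowered_elts[OF crys[OF \<nu>] u_elts[OF \<nu>] step(1)])
    from morphism_f_Some(2)[OF crys[OF \<nu>] m x x'(1) step(2)]
    obtain y' where "f y = Some y'" by auto
    moreover have "fop (W w) i x' = f y"
      using morphism_f_Some(1)[OF crys[OF \<nu>] m x x'(1), of i] step(2) by simp
    ultimately show ?case using lowered.step[OF x'(2), of i y'] by simp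
  qed
  with h show ?thesis by simp
qed

lemma word_lowered:
  assumes "x \<in> elts (W w)"
  shows "\<exists>h. highest (W w) h \<and> lowered (W w) h x"
proof -
  from word_embedding[OF assms] obtain \<nu> f b
    where f: "embeds \<nu> f (W w)" "b \<in> elts (B \<nu>)" "f b = Some x" by (elim exE conjE)
  from embedding_lowered[OF f(1,2)] f(3) obtain h where h: "f (u \<nu>) = Some h" "lowered (W w) h x"
    by auto
  have "morphism (B \<nu>) (W w) f" "highest (B \<nu>) (u \<nu>)"
    using f(1) u_highest by (simp_all add: embeds_def)
  then have "highest (W w) h" using h(1) by (rule morphism_highest)
  with h(2) show ?thesis by blast
qed

text \<open>The image is stable under all operators, and each of its elements is reached from
  \<open>h\<close> by a lowering path.\<close>

lemma component_embedding:
  assumes f: "embeds \<nu> f (W w)" "f (u \<nu>) = Some h"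
  shows "component (W w) h = {y. \<exists>b\<in>elts (B \<nu>). f b = Some y}"
proof -
  have \<nu>: "dominant \<nu>" and m: "morphism (B \<nu>) (W w) f" and t: "ptotal (B \<nu>) f"
    using f by (auto simp: embeds_def)
  let ?R = "{(x, y). x \<in> elts (W w) \<and> (\<exists>i. eop (W w) i x = Some y \<or> fop (W w) i x = Some y)}"
  show ?thesis
  proof (intro set_eqI iffI)
    fix y assume "y \<in> component (W w) h"
    then have "(h, y) \<in> ?R\<^sup>*" by (simp add: component_def)
    then show "y \<in> {y. \<exists>b\<in>elts (B \<nu>). f b = Some y}"
    proof (induction rule: rtrancl_induct)
      case base
      show ?case using f(2) u_elts[OF \<nu>] by blast
    next
      case (step x y)
      then obtain b i where b: "b \<in> elts (B \<nu>)" "f b = Some x"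
        and i: "eop (W w) i x = Some y \<or> fop (W w) i x = Some y" by blast
      show ?case
        using i morphism_e_Some(1)[OF crys[OF \<nu>] m b, of i] morphism_f_Some(1)[OF crys[OF \<nu>] m b, of i]
          crys_e[OF crys[OF \<nu>] b(1), of i] crys_f[OF crys[OF \<nu>] b(1), of i]
        by (auto simp: bind_eq_Some_conv)
    qed
  next
    fix y assume "y \<in> {y. \<exists>b\<in>elts (B \<nu>). f b = Some y}"
    then have low: "lowered (W w) h y" using embedding_lowered[OF f(1)] f(2) by fastforce
    have h: "h \<in> elts (W w)" by (rule morphism_elts[OF m u_elts[OF \<nu>] f(2)])
    from low have "(h, y) \<in> ?R\<^sup>*"
    proof (induction rule: lowered.induct)
      case (step x i y)
      then show ?case
        using lowered_elts[OF crys_word h step(1)] by (intro rtrancl_into_rtrancl[OF step.IH]) blast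
    qed simp
    then show "y \<in> component (W w) h" by (simp add: component_def)
  qed
qed

text \<open>Schur's lemma for components: both are copies of the same \<open>B \<nu>\<close>, and a
  competing map agrees at \<open>h\<close>, hence along all lowering paths. The predicate
  \<open>I\<close> has the shape of \<open>is_atom\<close>.\<close>

lemma component_iso:
  assumes h: "highest (W s) h" and h': "highest (W t) h'" and wt: "wt (W s) h = wt (W t) h'"
  defines "I \<equiv> \<lambda>f. morphism (W s) (W t) f \<and> f ` component (W s) h = Some ` component (W t) h'
      \<and> (\<forall>x. x \<notin> component (W s) h \<longrightarrow> f x = None)"
  shows "\<exists>f. I f \<and> pinj (W s) f \<and> f h = Some h' \<and> (\<forall>f'. I f' \<longrightarrow> f' = f)"
proof -
  define \<nu> where "\<nu> = wt (W s) h"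
  obtain i where i: "embeds \<nu> i (W s)" "i (u \<nu>) = Some h"
    using highest_embedding[OF h] unfolding \<nu>_def by blast
  obtain j where j: "embeds \<nu> j (W t)" "j (u \<nu>) = Some h'"
    using highest_embedding[OF h'] unfolding \<nu>_def wt by blast
  have \<nu>: "dominant \<nu>" and mi: "morphism (B \<nu>) (W s) i" and ti: "ptotal (B \<nu>) i" and pi: "pinj (B \<nu>) i"
    and mj: "morphism (B \<nu>) (W t) j" and tj: "ptotal (B \<nu>) j" and pj: "pinj (B \<nu>) j"
    using i j by (auto simp: embeds_def)
  note X = component_embedding[OF i] and Y = component_embedding[OF j]
  define f where "f = j \<circ>\<^sub>0 flip (B \<nu>) i"
  have mf: "morphism (W s) (W t) f"
    unfolding f_def by (rule morphism_comp[OF morphism_flip[OF crys[OF \<nu>] crys_word mi pi] mj])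
  have pf: "pinj (W s) f"
    unfolding f_def
    by (rule pinj_comp[OF morphism_flip[OF crys[OF \<nu>] crys_word mi pi] pinj_flip[OF pi] pj])
  have fi: "f x = j b" if "b \<in> elts (B \<nu>)" "i b = Some x" for x b
    using that flip_Some[OF pi, of x b] by (simp add: f_def comp_map_def)
  have fh: "f h = Some h'" using fi[OF u_elts[OF \<nu>] i(2)] j(2) by simp
  have f_None: "f x = None" if "x \<notin> component (W s) h" for x
    using that flip_None[of "B \<nu>" i x] by (auto simp: f_def comp_map_def X)
  have "f ` component (W s) h = Some ` component (W t) h'"
  proof (intro set_eqI iffI)
    fix z assume "z \<in> f ` component (W s) h"
    then obtain b where "b \<in> elts (B \<nu>)" "z = j b" using fi X by auto
    then show "z \<in> Some ` component (W t) h'" using ptotal_Some[OF tj, of b] Y by auto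
  next
    fix z assume "z \<in> Some ` component (W t) h'"
    then obtain b where b: "b \<in> elts (B \<nu>)" "z = j b" using Y by auto
    obtain x where "i b = Some x" using ptotal_Some[OF ti b(1)] by blast
    then show "z \<in> f ` component (W s) h" using fi[OF b(1)] b X by (intro image_eqI[of _ _ x]) auto
  qed
  with mf f_None have "I f" by (simp add: I_def)
  moreover have "f' = f" if "I f'" for f'
  proof
    fix x
    have m': "morphism (W s) (W t) f'" using that by (simp add: I_def)
    have hs: "h \<in> elts (W s)" using h by (simp add: highest_def)
    have "h \<in> component (W s) h" using X u_elts[OF \<nu>] i(2) by blast
    then have "f' h \<in> Some ` component (W t) h'" using that unfolding I_def by blast
    then obtain y b where y: "f' h = Some y" "b \<in> elts (B \<nu>)" "j b = Some y" using Y by auto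
    have "highest (W t) y" by (rule morphism_highest[OF m' h y(1)])
    \<comment> \<open>The image of \<open>h\<close> is highest in the other component, so its
      preimage in \<open>B \<nu>\<close> is the generator.\<close>
    then have "eop (B \<nu>) k b = None" for k
      using morphism_e_Some[OF crys[OF \<nu>] mj y(2,3), of k]
      by (cases "eop (B \<nu>) k b") (auto simp: highest_def)
    then have "b = u \<nu>" using y(2) by (intro highest_unique[OF \<nu>]) (simp add: highest_def)
    then have eq: "f' h = f h" using y j(2) fh by simp
    show "f' x = f x"
    proof (cases "x \<in> component (W s) h")
      case True
      then have "lowered (W s) h x" using embedding_lowered[OF i(1)] i(2) X by fastforce
      then show ?thesis
      proof (induction rule: lowered.induct)
        case (step x k y)
        have "x \<in> elts (W s)" by (rule lowered_elts[OF crys_word hs step(1)])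
        then show ?case using step morphism_f[OF mf, of x k] morphism_f[OF m', of x k] by simp
      qed (rule eq)
    next
      case False
      then show ?thesis using f_None that by (simp add: I_def)
    qed
  qed
  ultimately show ?thesis using pf fh by blast
qed

end

section \<open>Distinguished bottom diagrams\<close>

lemma word_weight_append: "word_weight (w @ v) = word_weight w + word_weight v"
  by (simp add: word_weight_def)

lemma word_weight_power_word: "word_weight (power_word m) = (\<lambda>i. int (m i))"
proof -
  have rep: "word_weight (replicate k i) j = (if j = i then int k else 0)" for k :: nat and i j :: 'a
    by (induction k) (auto simp: word_weight_def fund_weight_def)
  have "distinct xs \<Longrightarrow> word_weight (concat (map (\<lambda>i. replicate (m i) i) xs)) j
      = (if j \<in> set xs then int (m j) else 0)" for xs j
  proof (induction xs)
    case Nil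
    then show ?case by (simp add: word_weight_def)
  next
    case (Cons i xs)
    then show ?case by (auto simp: word_weight_append rep)
  qed
  then show ?thesis by (simp add: power_word_def fun_eq_iff)
qed

text \<open>Isolates the two crossing strands as a middle word, the form in which a crossing is
  padded by identities.\<close>

lemma swap_at_decomp:
  assumes "Suc p < length w"
  shows "w = take p w @ [w ! p, w ! Suc p] @ drop (Suc (Suc p)) w"
    and "swap_at p w = take p w @ [w ! Suc p, w ! p] @ drop (Suc (Suc p)) w"
proof -
  have 1: "w = take p w @ w ! p # w ! Suc p # drop (Suc (Suc p)) w"
    using assms by (metis Cons_nth_drop_Suc Suc_lessD append_take_drop_id)
  then show "w = take p w @ [w ! p, w ! Suc p] @ drop (Suc (Suc p)) w" by simp
  have "length (take p w) = p" using assms by simp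
  then have "(take p w @ x # y # drop (Suc (Suc p)) w)[p := a, Suc p := b] = take p w @ a # b # drop (Suc (Suc p)) w"
    for x y a b by (simp add: list_update_append)
  then show "swap_at p w = take p w @ [w ! Suc p, w ! p] @ drop (Suc (Suc p)) w"
    unfolding swap_at_def using 1 by (metis append_Cons append_Nil)
qed

lemma length_swap_at [simp]: "length (swap_at p w) = length w"
  by (simp add: swap_at_def)

lemma swap_at_map: "Suc p < length s \<Longrightarrow> swap_at p (map l s) = map l (swap_at p s)"
  by (simp add: swap_at_def map_update)

lemma word_weight_swap_at: "Suc p < length w \<Longrightarrow> word_weight (swap_at p w) = word_weight w"
  by (subst (2) swap_at_decomp(1), assumption, subst swap_at_decomp(2), assumption)
    (simp add: word_weight_append word_weight_def add_ac)

lemma word_weight_crossing_target: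
  "\<forall>p\<in>set ps. Suc p < length w \<Longrightarrow> word_weight (crossing_target w ps) = word_weight w"
  by (induction ps arbitrary: w) (auto simp: word_weight_swap_at)

lemma Cons_elts_iff:
  "b # x \<in> elts (word_crystal B (k # w)) \<longleftrightarrow> b \<in> elts (B (fund_weight k)) \<and> x \<in> elts (word_crystal B w)"
  by auto

lemma singleton_elts_iff: "[b] \<in> elts (word_crystal B [k]) \<longleftrightarrow> b \<in> elts (B (fund_weight k))"
  by (auto simp: unit_crystal_def)

context crystal_family
begin

definition top_word :: "'n list \<Rightarrow> 'b list" where
  "top_word w = map (\<lambda>i. u (fund_weight i)) w"

lemma top_word_append: "top_word (w @ v) = top_word w @ top_word v"
  by (simp add: top_word_def)

text \<open>Multiplicity one of the top weight. In the equality case of a cons neither summand can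
  lie below its own bound, by \<open>weight_le_add_eqD\<close>; hence bound and equality case are
  proved together.\<close>

lemma word_wt_le:
  "x \<in> elts (W w) \<Longrightarrow>
    weight_le A (wt (W w) x) (word_weight w) \<and> (wt (W w) x = word_weight w \<longrightarrow> x = top_word w)"
proof (induction w arbitrary: x)
  case Nil
  then show ?case
    by (simp add: top_word_def word_weight_def unit_crystal_def weight_le_refl zero_fun_def)
next
  case (Cons k w)
  then obtain b x' where x: "x = b # x'" "b \<in> elts (B (fund_weight k))" "x' \<in> elts (W w)" by auto
  have b: "weight_le A (wt (B (fund_weight k)) b) (fund_weight k)" by (rule wt_le[OF dominant_fund x(2)])
  have x': "weight_le A (wt (W w) x') (word_weight w)" using Cons.IH[OF x(3)] by simp
  have ww: "word_weight (k # w) = fund_weight k + word_weight w" by (simp add: word_weight_def)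
  have wx: "wt (W (k # w)) x = wt (B (fund_weight k)) b + wt (W w) x'" by (simp add: x(1))
  have "weight_le A (wt (W (k # w)) x) (word_weight (k # w))"
    unfolding ww wx by (rule weight_le_add[OF b x'])
  moreover have "x = top_word (k # w)" if "wt (W (k # w)) x = word_weight (k # w)"
    using weight_le_add_eqD[OF b x' that[unfolded ww wx] indep] wt_eq_imp_u[OF dominant_fund x(2)]
      Cons.IH[OF x(3)] x(1) by (simp add: top_word_def)
  ultimately show ?case by blast
qed

lemma top_word_elts: "top_word w \<in> elts (W w)" "wt (W w) (top_word w) = word_weight w"
proof (induction w)
  case (Cons k w)
  { case 1
    then show ?case
      using Cons u_elts[OF dominant_fund]
      by (simp del: word_crystal.simps add: top_word_def Cons_elts_iff)
  next
    case 2
    then show ?case using Cons u_wt[OF dominant_fund] by (simp add: top_word_def word_weight_def)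
  }
qed (simp_all add: top_word_def word_weight_def unit_crystal_def zero_fun_def)

lemma top_word_highest: "highest (W w) (top_word w)"
  by (rule highestI[OF crys_word top_word_elts(1)]) (simp add: top_word_elts word_wt_le)

lemma word_highest_eq: "word_highest B w = top_word w"
  unfolding word_highest_def
  using top_word_highest top_word_elts(2) word_wt_le by (intro the_equality) (auto simp: highest_def)

lemma highest_phi: "highest (W w) h \<Longrightarrow> int (phi (W w) i h) = wt (W w) h i"
  using crys_phi[OF crys_word, of h w i] by (simp add: highest_def eps_None)

text \<open>For the top element of \<open>e\<close>, each \<open>phi\<close> equals the
  corresponding \<open>eps\<close> of \<open>b\<close>, so appending \<open>b\<close> stays highest;
  adding the weight of \<open>b\<close> turns these numbers into \<open>phi\<close> of
  \<open>b\<close>, the top weight of \<open>p\<close>. \<open>component_iso\<close> then gives the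
  description of \<open>atom\<close> exactly one solution.\<close>

lemma atom_props:
  assumes b: "b \<in> elts (B (fund_weight k))"
  defines "e \<equiv> eps_word B k b" and "p \<equiv> phi_word B k b"
  shows "morphism (W (e @ [k])) (W p) (atom B k b)" "pinj (W (e @ [k])) (atom B k b)"
    "atom B k b (top_word e @ [b]) = Some (top_word p)"
proof -
  have bk: "[b] \<in> elts (W [k])" using b by (simp only: singleton_elts_iff)
  have "phi (W e) i (top_word e) = eps (B (fund_weight k)) i b" for i
    using highest_phi[OF top_word_highest, of e i]
    by (simp add: top_word_elts e_def eps_word_def word_weight_power_word)
  then have h: "highest (W (e @ [k])) (top_word e @ [b])"
    using highest_append[OF top_word_elts(1) bk] top_word_highest word_singleton(1)[OF b] by simp
  have "wt (W (e @ [k])) (top_word e @ [b]) = wt (W p) (top_word p)"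
    using append_wt[OF top_word_elts(1) bk] crys_phi[OF crys_fund b] word_singleton(3)[OF b]
    by (simp add: top_word_elts e_def p_def eps_word_def phi_word_def word_weight_power_word fun_eq_iff)
  from component_iso[OF h top_word_highest this]
  have "\<exists>f. is_atom B k b f \<and> pinj (W (e @ [k])) f \<and> f (top_word e @ [b]) = Some (top_word p)
      \<and> (\<forall>f'. is_atom B k b f' \<longrightarrow> f' = f)"
    unfolding is_atom_def Let_def word_highest_eq e_def p_def .
  then obtain f where f: "is_atom B k b f" "pinj (W (e @ [k])) f"
    "f (top_word e @ [b]) = Some (top_word p)" "\<forall>f'. is_atom B k b f' \<longrightarrow> f' = f"
    by (elim exE conjE)
  have "atom B k b = f" unfolding atom_def using f(1,4) by (intro the_equality) blast+
  with f(1-3) show "morphism (W (e @ [k])) (W p) (atom B k b)" "pinj (W (e @ [k])) (atom B k b)"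
    "atom B k b (top_word e @ [b]) = Some (top_word p)"
    by (simp_all add: is_atom_def Let_def e_def p_def)
qed

text \<open>Words are written as \<open>map l s\<close>, with strands \<open>s\<close> and labels
  \<open>l\<close>, because the log names strands while a crossing depends on labels. Each crossing
  is invertible, hence total and injective.\<close>

lemma crossing_map_props:
  assumes \<beta>: "is_crossings B \<beta>"
  shows "\<forall>p\<in>set ps. Suc p < length s \<Longrightarrow> \<forall>(x, y)\<in>set (crossing_log s ps). l x \<noteq> l y \<Longrightarrow>
    morphism (W (map l s)) (W (crossing_target (map l s) ps)) (crossing_map \<beta> (map l s) ps) \<and>
    pinj (W (map l s)) (crossing_map \<beta> (map l s) ps) \<and>
    ptotal (W (map l s)) (crossing_map \<beta> (map l s) ps)"
proof (induction ps arbitrary: s)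
  case Nil
  then show ?case by (simp add: morphism_id pinj_id ptotal_def)
next
  case (Cons p ps)
  define w where "w = map l s"
  define i j where "i = w ! p" and "j = w ! Suc p"
  define a c where "a = take p w" and "c = drop (Suc (Suc p)) w"
  have p: "Suc p < length w" using Cons.prems(1) by (simp add: w_def)
  have w: "w = a @ [i, j] @ c" and sw: "swap_at p w = a @ [j, i] @ c"
    using swap_at_decomp[OF p] by (simp_all add: a_def c_def i_def j_def)
  have len: "length a = p" using p by (simp add: a_def)
  \<comment> \<open>The pair crossed first is the head of the log.\<close>
  have "i \<noteq> j" using Cons.prems p by (simp add: i_def j_def w_def)
  then have m: "morphism (W [i, j]) (W [j, i]) (\<beta> i j)"
    and inv: "\<And>x. x \<in> elts (W [i, j]) \<Longrightarrow> (\<beta> j i \<circ>\<^sub>0 \<beta> i j) x = Some x"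
    using \<beta> unfolding is_crossings_def by blast+
  have "ptotal (W [i, j]) (\<beta> i j)"
    unfolding ptotal_def
  proof (intro ballI notI)
    fix x assume "x \<in> elts (W [i, j])" "\<beta> i j x = None"
    with inv[of x] show False by (simp add: comp_map_def del: word_crystal.simps)
  qed
  moreover have "pinj (W [i, j]) (\<beta> i j)"
    unfolding pinj_def
  proof (intro ballI allI impI)
    fix x x' y assume "x \<in> elts (W [i, j])" "x' \<in> elts (W [i, j])" "\<beta> i j x = Some y" "\<beta> i j x' = Some y"
    with inv[of x] inv[of x'] show "x = x'" by (simp only: comp_map_def bind.bind_lunit option.inject) 
  qed
  ultimately have t: "ptotal (W ([i, j] @ c)) (tensor_map 2 (\<beta> i j) Some)"
    and i: "pinj (W ([i, j] @ c)) (tensor_map 2 (\<beta> i j) Some)"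
    and m: "morphism (W ([i, j] @ c)) (W ([j, i] @ c)) (tensor_map 2 (\<beta> i j) Some)"
    using ptotal_tensor_map[of "[i, j]" "\<beta> i j" c Some] pinj_tensor_map[OF m, of c Some]
      morphism_tensor_map[OF m morphism_id, of c]
    by (simp_all add: pinj_id ptotal_def numeral_2_eq_2 del: word_crystal.simps append.simps)
  define g where "g = tensor_map p Some (tensor_map 2 (\<beta> i j) Some)"
  have "morphism (W (a @ [i, j] @ c)) (W (a @ [j, i] @ c)) g"
    unfolding g_def using morphism_tensor_map[OF morphism_id m, of a] by (simp only: len)
  note mg = this[folded sw, folded w]
  have "pinj (W (a @ [i, j] @ c)) g"
    unfolding g_def using pinj_tensor_map[OF morphism_id pinj_id i, of a] by (simp only: len)
  note ig = this[folded w]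
  have "ptotal (W (a @ [i, j] @ c)) g"
    unfolding g_def using ptotal_tensor_map[OF _ t, of a Some] by (simp only: len) (simp add: ptotal_def)
  note tg = this[folded w]
  have sw': "swap_at p w = map l (swap_at p s)"
    using p unfolding w_def by (intro swap_at_map) simp
  note IH = Cons.IH[of "swap_at p s", folded sw']
  have IH: "morphism (W (swap_at p w)) (W (crossing_target (swap_at p w) ps)) (crossing_map \<beta> (swap_at p w) ps) \<and>
    pinj (W (swap_at p w)) (crossing_map \<beta> (swap_at p w) ps) \<and>
    ptotal (W (swap_at p w)) (crossing_map \<beta> (swap_at p w) ps)"
    using Cons.prems by (intro IH) auto
  have eq: "crossing_map \<beta> w (p # ps) = crossing_map \<beta> (swap_at p w) ps \<circ>\<^sub>0 g"
    by (simp add: g_def i_def j_def)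
  show ?case
    unfolding w_def[symmetric] eq crossing_target.simps
    using IH by (intro conjI morphism_comp[OF mg] pinj_comp[OF mg ig] ptotal_comp[OF mg tg]; elim conjE)
qed

text \<open>A permutation is total and preserves weights, so the top element goes to an element of
  top weight, and multiplicity one leaves a single candidate.\<close>

lemma permutation_props:
  assumes \<beta>: "is_crossings B \<beta>" and P: "is_permutation w ps w'"
  shows "morphism (W w) (W w') (crossing_map \<beta> w ps)" "pinj (W w) (crossing_map \<beta> w ps)"
    "crossing_map \<beta> w ps (top_word w) = Some (top_word w')"
proof -
  have ps: "\<forall>p\<in>set ps. Suc p < length w" and log: "\<forall>(x, y)\<in>set (crossing_log [0..<length w] ps). w ! x \<noteq> w ! y"
    and w': "crossing_target w ps = w'"
    using P unfolding is_permutation_def Let_def by blast+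
  have *: "morphism (W w) (W w') (crossing_map \<beta> w ps) \<and> pinj (W w) (crossing_map \<beta> w ps)
      \<and> ptotal (W w) (crossing_map \<beta> w ps)"
    using crossing_map_props[OF \<beta>, of ps "[0..<length w]" "(!) w"] ps log w' by (simp add: map_nth)
  then show m: "morphism (W w) (W w') (crossing_map \<beta> w ps)" and "pinj (W w) (crossing_map \<beta> w ps)"
    by blast+
  from * obtain y where y: "crossing_map \<beta> w ps (top_word w) = Some y"
    using ptotal_Some[OF _ top_word_elts(1)] by auto
  have "wt (W w') y = word_weight w'"
    using morphism_wt[OF m top_word_elts(1) y] word_weight_crossing_target[OF ps] w'
    by (simp add: top_word_elts)
  then have "y = top_word w'" using word_wt_le morphism_elts[OF m top_word_elts(1) y] by blast
  then show "crossing_map \<beta> w ps (top_word w) = Some (top_word w')" using y by simp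
qed

lemma diagram_props:
  assumes \<beta>: "is_crossings B \<beta>" and D: "is_diagram_system B \<beta> D"
  shows "highest (W w) h \<Longrightarrow> morphism (W w) (W (fst (D w h))) (snd (D w h)) \<and>
    pinj (W w) (snd (D w h)) \<and> snd (D w h) h = Some (top_word (fst (D w h)))"
proof (induction w arbitrary: h rule: rev_induct)
  case Nil
  then have "h = []" by (simp add: highest_def unit_crystal_def)
  then show ?case using D by (simp add: is_diagram_system_def morphism_id pinj_id top_word_def)
next
  case (snoc k w)
  then obtain h' b where h: "h = h' @ [b]" "h' \<in> elts (W w)" "b \<in> elts (B (fund_weight k))"
    by (auto simp: highest_def elts_append unit_crystal_def)
  have bk: "[b] \<in> elts (W [k])" using h(3) by (simp only: singleton_elts_iff)
  have h': "highest (W w) h'" using snoc.prems highest_append[OF h(2) bk] h(1) by simp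
  obtain ps w0 where ps: "is_minimal_permutation (fst (D w h')) (eps_word B k b) ps w0"
    and Dh: "D (w @ [k]) h = extend_diagram B \<beta> w k b (D w h') ps w0"
    using D snoc.prems unfolding is_diagram_system_def h(1) by blast
  define e p where "e = eps_word B k b" and "p = phi_word B k b"
  define c \<phi> where "c = fst (D w h')" and "\<phi> = snd (D w h')"
  have IH: "morphism (W w) (W c) \<phi>" "pinj (W w) \<phi>" "\<phi> h' = Some (top_word c)"
    using snoc.IH[OF h'] by (simp_all add: c_def \<phi>_def)
  have "is_permutation c ps (w0 @ e)"
    using ps by (simp add: is_minimal_permutation_def c_def e_def)
  note P = permutation_props[OF \<beta> this]
  define \<psi> where "\<psi> = crossing_map \<beta> c ps \<circ>\<^sub>0 \<phi>"
  have \<psi>: "morphism (W w) (W (w0 @ e)) \<psi>" "pinj (W w) \<psi>" "\<psi> h' = Some (top_word (w0 @ e))"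
    using morphism_comp[OF IH(1) P(1)] pinj_comp[OF IH(1,2) P(2)] IH(3) P(3)
    by (simp_all add: \<psi>_def comp_map_def)
  define f1 where "f1 = tensor_map (length w) \<psi> Some"
  have f1: "morphism (W (w @ [k])) (W (w0 @ e @ [k])) f1" "pinj (W (w @ [k])) f1"
    "f1 h = Some (top_word w0 @ top_word e @ [b])"
    using morphism_tensor_map[OF \<psi>(1) morphism_id, of "[k]"] pinj_tensor_map[OF \<psi>(1,2) pinj_id, of "[k]"]
      tensor_map_append[OF h(2), of \<psi> Some "[b]"] \<psi>(3)
    by (simp_all only: f1_def h(1) append_assoc top_word_append bind.bind_lunit option.map)
  define f2 where "f2 = tensor_map (length w0) Some (atom B k b)"
  \<comment> \<open>The image of \<open>h\<close> under \<open>f1\<close> ends in the generator of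
    the component that the atom does not kill, so the atom sends that part to a top element.\<close>
  note a = atom_props[OF h(3), folded e_def p_def]
  have f2: "morphism (W (w0 @ e @ [k])) (W (w0 @ p)) f2" "pinj (W (w0 @ e @ [k])) f2"
    "f2 (top_word w0 @ top_word e @ [b]) = Some (top_word (w0 @ p))"
    using morphism_tensor_map[OF morphism_id a(1), of w0] pinj_tensor_map[OF morphism_id pinj_id a(2), of w0]
      tensor_map_append[OF top_word_elts(1), of w0 Some "atom B k b" "top_word e @ [b]"] a(3)
    by (simp_all only: f2_def top_word_append bind.bind_lunit option.map)
  have "D (w @ [k]) h = (w0 @ p, f2 \<circ>\<^sub>0 f1)"
    by (simp add: Dh extend_diagram_def f1_def f2_def \<psi>_def c_def \<phi>_def p_def)
  then show ?case
    using morphism_comp[OF f1(1) f2(1)] pinj_comp[OF f1(1,2) f2(2)] f1(3) f2(3)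
    by (simp add: comp_map_def)
qed

end

section \<open>Triangular families\<close>

text \<open>Elimination against the functionals \<open>\<tau>\<close>. Unitriangularity with respect
  to the rank \<open>r\<close> gives independence; combined with \<open>\<tau>\<close> separating
  the points of \<open>V\<close> it gives spanning.\<close>

lemma (in vector_space) triangular_basis:
  fixes b :: "'i \<Rightarrow> 'b" and \<tau> :: "'i \<Rightarrow> 'b \<Rightarrow> 'a" and r :: "'i \<Rightarrow> nat"
  assumes fin: "finite I"
    and add: "\<And>p x y. \<tau> p (x + y) = \<tau> p x + \<tau> p y" and sc: "\<And>p a x. \<tau> p (scale a x) = a * \<tau> p x"
    and one: "\<And>p. p \<in> I \<Longrightarrow> \<tau> p (b p) = 1"
    and tri: "\<And>p q. p \<in> I \<Longrightarrow> q \<in> I \<Longrightarrow> \<tau> p (b q) \<noteq> 0 \<Longrightarrow> p = q \<or> r p < r q"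
    and V: "subspace V" "b ` I \<subseteq> V" "\<And>x. x \<in> V \<Longrightarrow> (\<And>p. p \<in> I \<Longrightarrow> \<tau> p x = 0) \<Longrightarrow> x = 0"
  shows "independent (b ` I) \<and> span (b ` I) = V"
proof
  have zero: "\<tau> p 0 = 0" for p using sc[of p 0 0] by simp
  have sum: "\<tau> p (\<Sum>x\<in>S. g x) = (\<Sum>x\<in>S. \<tau> p (g x))" for p S and g :: "'c \<Rightarrow> 'b"
    by (induction S rule: infinite_finite_induct) (simp_all add: zero add)
  show "independent (b ` I)"
  proof (rule independent_if_scalars_zero)
    fix c x assume c: "(\<Sum>x\<in>b ` I. scale (c x) x) = 0" and x: "x \<in> b ` I"
    show "c x = 0"
    proof (rule ccontr)
      assume "c x \<noteq> 0"
      define J where "J = {p\<in>I. c (b p) \<noteq> 0}"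
      have "J \<noteq> {}" "finite J" using x \<open>c x \<noteq> 0\<close> fin by (auto simp: J_def)
      \<comment> \<open>An index of maximal rank in the support: under \<open>\<tau> p\<close> every
        other term vanishes, as it would need a larger rank.\<close>
      then obtain p where p: "p \<in> J" "\<And>q. q \<in> J \<Longrightarrow> r q \<le> r p"
        using Max_in[of "r ` J"] Max_ge[of "r ` J"] by (fastforce simp: image_iff)
      have "0 = \<tau> p (\<Sum>x\<in>b ` I. scale (c x) x)" by (simp add: c zero)
      also have "\<dots> = (\<Sum>x\<in>b ` I. c x * \<tau> p x)" by (simp add: sum sc)
      also have "\<dots> = (\<Sum>x\<in>{b p}. c x * \<tau> p x)"
      proof (rule sum.mono_neutral_right)
        show "\<forall>x\<in>b ` I - {b p}. c x * \<tau> p x = 0"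
        proof
          fix y assume "y \<in> b ` I - {b p}"
          then obtain q where q: "q \<in> I" "y = b q" "p \<noteq> q" by blast
          show "c y * \<tau> p y = 0"
          proof (rule ccontr)
            assume "c y * \<tau> p y \<noteq> 0"
            then have "q \<in> J" "\<tau> p (b q) \<noteq> 0" using q by (auto simp: J_def)
            then have "r p < r q" using tri[of p q] p(1) q by (auto simp: J_def)
            with p(2)[OF \<open>q \<in> J\<close>] show False by simp
          qed
        qed
      qed (use fin p in \<open>auto simp: J_def\<close>)
      also have "\<dots> = c (b p)" using one p(1) by (simp add: J_def)
      finally show False using p(1) by (simp add: J_def)
    qed
  qed (use fin in simp)
  show "span (b ` I) = V"
  proof
    show "span (b ` I) \<subseteq> V" by (rule span_minimal[OF V(2,1)])
    show "V \<subseteq> span (b ` I)"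
    proof
      fix x assume x: "x \<in> V"
      \<comment> \<open>The coefficients are cleared in order of decreasing \<open>r\<close>.\<close>
      have "\<exists>y\<in>span (b ` I). \<forall>p\<in>I. n \<le> r p \<longrightarrow> \<tau> p (x - y) = 0" if "n \<le> N" "\<forall>p\<in>I. r p < N" for n N
        using that(1)
      proof (induction rule: inc_induct)
        case base
        show ?case using that(2) by (intro bexI[of _ 0]) (auto simp: span_zero)
      next
        case (step n)
        then obtain y where y: "y \<in> span (b ` I)" "\<forall>p\<in>I. Suc n \<le> r p \<longrightarrow> \<tau> p (x - y) = 0" by blast
        define J where "J = {p\<in>I. r p = n}"
        define z where "z = (\<Sum>p\<in>J. scale (\<tau> p (x - y)) (b p))"
        have "z \<in> span (b ` I)"
          unfolding z_def by (intro span_sum span_scale span_base) (auto simp: J_def)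
        moreover have "\<tau> p (x - (y + z)) = 0" if p: "p \<in> I" "n \<le> r p" for p
        proof -
          have "x - y = (x - (y + z)) + z" by simp
          then have "\<tau> p (x - y) = \<tau> p (x - (y + z)) + \<tau> p z" by (metis add)
          moreover have "\<tau> p z = (\<Sum>q\<in>J. \<tau> q (x - y) * \<tau> p (b q))" by (simp add: z_def sum sc)
          moreover have "\<dots> = (\<Sum>q\<in>J. if q = p then \<tau> p (x - y) else 0)"
          proof (rule sum.cong)
            fix q assume "q \<in> J"
            then show "\<tau> q (x - y) * \<tau> p (b q) = (if q = p then \<tau> p (x - y) else 0)"
              using one p tri[of p q] by (auto simp: J_def)
          qed simp
          \<comment> \<open>If \<open>r p > n\<close>, then \<open>p\<close> is not in
            \<open>J\<close> and both sides vanish by the choice of \<open>y\<close>.\<close>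
          moreover have "\<dots> = \<tau> p (x - y)"
            using y(2) p fin by (auto simp: J_def)
          ultimately show ?thesis by simp
        qed
        ultimately show ?case using y(1) by (intro bexI[of _ "y + z"]) (auto intro: span_add)
      qed
      moreover have "\<forall>p\<in>I. r p < Suc (Max (r ` I))" using fin by (auto simp: less_Suc_eq_le)
      ultimately obtain y where y: "y \<in> span (b ` I)" "\<forall>p\<in>I. \<tau> p (x - y) = 0"
        by (meson le0)
      have "y \<in> V" using y(1) span_minimal[OF V(2,1)] by blast
      then have "x - y = 0" using y(2) by (intro V(3)) (auto intro: subspace_diff[OF V(1) x])
      then show "x \<in> span (b ` I)" using y(1) by simp
    qed
  qed
qed

section \<open>Linear combinations of morphisms\<close>

lemma vector_space_map_scale: "vector_space map_scale"
  by unfold_locales (auto simp: map_scale_def fun_eq_iff algebra_simps)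

abbreviation \<delta> :: "'a \<Rightarrow> 'a \<Rightarrow> 'k::field" where
  "\<delta> x \<equiv> (\<lambda>y. if y = x then 1 else 0)"

lemma lin_\<delta>: "finite (elts C) \<Longrightarrow> lin C f (\<delta> x) y = (if x \<in> elts C \<and> f x = Some y then 1 else 0)"
  by (auto simp: lin_def)

lemma lin_expand: "finite (elts C) \<Longrightarrow> lin C f v y = (\<Sum>x\<in>elts C. v x * lin C f (\<delta> x) y)"
proof -
  assume fin: "finite (elts C)"
  have "lin C f v y = (\<Sum>x\<in>{x \<in> elts C. f x = Some y}. v x)" by (simp add: lin_def)
  also have "\<dots> = (\<Sum>x\<in>elts C. if f x = Some y then v x else 0)"
    by (rule sum.inter_filter[OF fin])
  also have "\<dots> = (\<Sum>x\<in>elts C. v x * lin C f (\<delta> x) y)"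
    by (rule sum.cong) (auto simp: lin_\<delta>[OF fin])
  finally show ?thesis .
qed

text \<open>Properties of morphisms that survive linear combinations. Commutation with lowering is
  stated for matrix entries: the entry at \<open>y\<close> after lowering the argument is the entry
  at the raised \<open>y\<close>, and 0 if \<open>y\<close> cannot be raised or lies outside
  \<open>D\<close>.\<close>

definition crystal_linear :: "('n, 'b) crystal \<Rightarrow> ('n, 'c) crystal \<Rightarrow> (('b \<Rightarrow> 'k::field) \<Rightarrow> 'c \<Rightarrow> 'k) \<Rightarrow> bool" where
  "crystal_linear C D T \<longleftrightarrow>
     (\<forall>v y. T v y = (\<Sum>x\<in>elts C. v x * T (\<delta> x) y))
   \<and> (\<forall>x y. highest C x \<longrightarrow> \<not> (highest D y \<and> wt D y = wt C x) \<longrightarrow> T (\<delta> x) y = 0)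
   \<and> (\<forall>i x x' y. x \<in> elts C \<longrightarrow> fop C i x = Some x' \<longrightarrow> T (\<delta> x') y =
        (if y \<in> elts D then case eop D i y of None \<Rightarrow> 0 | Some y' \<Rightarrow> T (\<delta> x) y' else 0))"

lemma crystal_linear_expand: "crystal_linear C D T \<Longrightarrow> T v y = (\<Sum>x\<in>elts C. v x * T (\<delta> x) y)"
  unfolding crystal_linear_def by blast

lemma crystal_linear_highest:
  "crystal_linear C D T \<Longrightarrow> highest C x \<Longrightarrow> \<not> (highest D y \<and> wt D y = wt C x) \<Longrightarrow> T (\<delta> x) y = 0"
  unfolding crystal_linear_def by blast

lemma crystal_linear_lower:
  "crystal_linear C D T \<Longrightarrow> x \<in> elts C \<Longrightarrow> fop C i x = Some x' \<Longrightarrow> T (\<delta> x') y =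
    (if y \<in> elts D then case eop D i y of None \<Rightarrow> 0 | Some y' \<Rightarrow> T (\<delta> x) y' else 0)"
  unfolding crystal_linear_def by blast

lemma crystal_linear_lin:
  assumes C: "crys A C" and D: "crys A D" and f: "morphism C D f"
  shows "crystal_linear C D (lin C f)"
  unfolding crystal_linear_def
proof (intro conjI allI impI)
  note fin = crys_finite[OF C]
  note d = lin_\<delta>[OF fin]
  show "lin C f v y = (\<Sum>x\<in>elts C. v x * lin C f (\<delta> x) y)" for v y
    by (rule lin_expand[OF fin])
  show "lin C f (\<delta> x) y = 0" if "highest C x" "\<not> (highest D y \<and> wt D y = wt C x)" for x y
    using that morphism_highest[OF f that(1)] morphism_wt[OF f, of x y] by (auto simp: d highest_def)
  fix i x x' y assume x: "x \<in> elts C" "fop C i x = Some x'"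
  then have x': "x' \<in> elts C" using crys_f[OF C x] by simp
  have fx': "f x' = Option.bind (f x) (fop D i)" using morphism_f[OF f x(1), of i] x(2) by simp
  show "lin C f (\<delta> x') y = (if y \<in> elts D then case eop D i y of None \<Rightarrow> 0 | Some y' \<Rightarrow> lin C f (\<delta> x) y' else 0)"
  proof (cases "y \<in> elts D")
    case True
    have "f x' = Some y \<longleftrightarrow> (\<exists>y'. eop D i y = Some y' \<and> f x = Some y')"
      unfolding fx' bind_eq_Some_conv
      using morphism_elts[OF f x(1)] crys_e[OF D True, of i] crys_f[OF D, of _ i y] by blast
    then show ?thesis using True x(1) x' by (auto simp: d split: option.splits)
  next
    case False
    then show ?thesis using morphism_elts[OF f x'] by (auto simp: d)
  qed
qed

text \<open>The conditions are linear in \<open>T\<close>, so they pass from single morphisms to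
  their span.\<close>

lemma crystal_linear_hom:
  assumes C: "crys A C" and D: "crys A D" and T: "T \<in> gcrys_hom C D"
  shows "crystal_linear C D T"
proof -
  interpret vector_space "map_scale :: 'd::field \<Rightarrow> (('b \<Rightarrow> 'd) \<Rightarrow> ('c \<Rightarrow> 'd)) \<Rightarrow> _"
    by (rule vector_space_map_scale)
  have "subspace {T. crystal_linear C D T}"
  proof (rule subspaceI, unfold mem_Collect_eq)
    show "crystal_linear C D 0" by (simp add: crystal_linear_def split: option.splits)
    show "crystal_linear C D (S + T)" if S: "crystal_linear C D S" and T: "crystal_linear C D T" for S T
      unfolding crystal_linear_def
    proof (intro conjI allI impI)
      fix v y
      have "(S + T) v y = S v y + T v y" by simp
      also have "\<dots> = (\<Sum>x\<in>elts C. v x * S (\<delta> x) y) + (\<Sum>x\<in>elts C. v x * T (\<delta> x) y)"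
        by (rule arg_cong2[OF crystal_linear_expand[OF S] crystal_linear_expand[OF T], where f = "(+)"])
      finally show "(S + T) v y = (\<Sum>x\<in>elts C. v x * (S + T) (\<delta> x) y)"
        by (simp add: distrib_left sum.distrib)
    qed (simp_all add: crystal_linear_highest[OF S] crystal_linear_highest[OF T]
        crystal_linear_lower[OF S] crystal_linear_lower[OF T] split: option.splits)
    show "crystal_linear C D (map_scale a T)" if T: "crystal_linear C D T" for a T
      unfolding crystal_linear_def
    proof (intro conjI allI impI)
      fix v y
      have "map_scale a T v y = a * T v y" by (simp add: map_scale_def)
      also have "\<dots> = a * (\<Sum>x\<in>elts C. v x * T (\<delta> x) y)"
        by (rule arg_cong[OF crystal_linear_expand[OF T]])
      finally show "map_scale a T v y = (\<Sum>x\<in>elts C. v x * map_scale a T (\<delta> x) y)"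
        by (simp add: map_scale_def sum_distrib_left mult.left_commute)
    qed (simp_all add: map_scale_def crystal_linear_highest[OF T] crystal_linear_lower[OF T]
        split: option.splits)
  qed
  with T[unfolded gcrys_hom_def] show ?thesis
    by (rule span_induct[where P = "crystal_linear C D"]) (use crystal_linear_lin[OF C D] in blast)
qed

text \<open>Each lowering step of the argument moves an entry back to one at the preceding element
  of the path, until a highest weight element is reached.\<close>

lemma crystal_linear_eq_0:
  assumes C: "crys A C" and T: "crystal_linear C D T"
    and low: "\<And>x. x \<in> elts C \<Longrightarrow> \<exists>h. highest C h \<and> lowered C h x"
    and 0: "\<And>h h'. highest C h \<Longrightarrow> highest D h' \<Longrightarrow> wt D h' = wt C h \<Longrightarrow> T (\<delta> h) h' = 0"
  shows "T = 0"
proof -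
  have "T (\<delta> x) y = 0" if h: "highest C h" and "lowered C h x" for h x y
    using that(2)
  proof (induction arbitrary: y rule: lowered.induct)
    case refl
    show ?case using 0[OF h, of y] crystal_linear_highest[OF T h, of y] by blast
  next
    case (step x i x')
    have "x \<in> elts C" using lowered_elts[OF C _ step(1)] h by (simp add: highest_def)
    then show ?case
      by (subst crystal_linear_lower[OF T _ step(2)]) (auto simp: step.IH split: option.splits)
  qed
  then have "T (\<delta> x) y = 0" if "x \<in> elts C" for x y using low[OF that] by blast
  then have "T v y = 0" for v y
    by (subst crystal_linear_expand[OF T]) simp
  then show ?thesis by (simp add: fun_eq_iff)
qed

section \<open>Crystals of simple modules\<close>

text \<open>The elements of the module crystal are by construction those obtained by lowering the
  class of the highest weight vector; the isomorphism pulls these paths back to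
  \<open>C\<close>.\<close>

lemma simple_module_crystal_generated:
  assumes "simple_module_crystal A \<mu> C"
  shows "\<exists>x\<in>elts C. wt C x = \<mu> \<and> (\<forall>y\<in>elts C. lowered C x y)"
proof -
  from assms obtain d M u g where bij: "bij_betw g (elts C) (module_crystal_elts A d M \<mu> u)"
    and g: "morphism C (module_crystal A d M \<mu> u) (\<lambda>b. Some (g b))"
    unfolding simple_module_crystal_def crystal_iso_def by (auto simp: module_crystal_def)
  let ?b = "(\<mu>, residue_class A d M \<mu> u u)"
  have "?b \<in> g ` elts C" using bij module_crystal_elts.base by (auto simp: bij_betw_def)
  then obtain x where x: "x \<in> elts C" "g x = ?b" by force
  have "wt C x = \<mu>" using morphism_wt[OF g x(1)] x(2) by (simp add: module_crystal_def)
  have *: "\<exists>y\<in>elts C. g y = z \<and> lowered C x y" if "z \<in> module_crystal_elts A d M \<mu> u" for z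
    using that
  proof (induction rule: module_crystal_elts.induct)
    case base
    then show ?case using x lowered.refl by metis
  next
    case (step z i z')
    then obtain y where y: "y \<in> elts C" "g y = z" "lowered C x y" by blast
    have "Option.bind (fop C i y) (\<lambda>b. Some (g b)) = Some z'"
      using morphism_f[OF g y(1), of i] step(2) y(2) by (simp add: module_crystal_def)
    then obtain y' where y': "fop C i y = Some y'" "g y' = z'" by (auto simp: bind_eq_Some_conv)
    have "z' \<in> module_crystal_elts A d M \<mu> u" by (rule module_crystal_elts.step[OF step(1,2)])
    moreover have "y' \<in> elts C" using assms y(1) y'(1) unfolding simple_module_crystal_def is_crystal_def by blast
    ultimately show ?case using y' lowered.step[OF y(3) y'(1)] by blast
  qed
  have "lowered C x y" if "y \<in> elts C" for y
  proof -
    have "g y \<in> module_crystal_elts A d M \<mu> u" using bij that by (auto simp: bij_betw_def)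
    then obtain y' where "y' \<in> elts C" "g y' = g y" "lowered C x y'" using * by blast
    then show ?thesis using bij that by (metis bij_betw_def inj_onD)
  qed
  with x \<open>wt C x = \<mu>\<close> show ?thesis by blast
qed

lemma (in simple_lie_algebra) cartan_matrix_diag: "cartan_matrix \<alpha> coroot i i = 2"
  unfolding cartan_matrix_def
proof (rule the_equality)
  show *: "\<alpha> i (coroot i) = of_int 2" using coroots[of i] unfolding is_coroot_def by simp
  show "z = 2" if "\<alpha> i (coroot i) = of_int z" for z
    using that[unfolded *] by (simp only: of_int_eq_iff)
qed

lemma crystal_family_exists:
  fixes A :: "'n::{finite,linorder} \<Rightarrow> 'n \<Rightarrow> int" and B :: "'n weight \<Rightarrow> ('n, 'b) crystal"
  assumes A: "\<And>i. A i i = 2"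
    and crystals: "\<And>\<mu>. dominant \<mu> \<Longrightarrow> simple_module_crystal A \<mu> (B \<mu>)"
    and monoidal: "\<And>\<mu> \<nu>. dominant \<mu> \<Longrightarrow> dominant \<nu> \<Longrightarrow> gcrys_object B (tensor (B \<mu>) (B \<nu>))"
  shows "\<exists>u. crystal_family A B u"
proof -
  have crys: "crys A (B \<mu>)" if "dominant \<mu>" for \<mu>
    using crystals[OF that] A by (simp add: crys_def simple_module_crystal_def)
  have "\<forall>\<mu>. \<exists>x. dominant \<mu> \<longrightarrow> x \<in> elts (B \<mu>) \<and> wt (B \<mu>) x = \<mu> \<and> (\<forall>y\<in>elts (B \<mu>). lowered (B \<mu>) x y)"
    using simple_module_crystal_generated[OF crystals] by blast
  from choice[OF this] obtain u where u: "\<forall>\<mu>. dominant \<mu> \<longrightarrow>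
      u \<mu> \<in> elts (B \<mu>) \<and> wt (B \<mu>) (u \<mu>) = \<mu> \<and> (\<forall>y\<in>elts (B \<mu>). lowered (B \<mu>) (u \<mu>) y)"
    by (elim exE)
  note u = u[rule_format]
  \<comment> \<open>The sum of the fundamental weights: all its coordinates are positive, as
    \<open>independent_columnsI\<close> demands. Its crystal also supplies the symmetrizer.\<close>
  define \<rho> where "\<rho> = (\<lambda>_ :: 'n. 1 :: int)"
  have \<rho>: "dominant \<rho>" by (simp add: dominant_def \<rho>_def)
  obtain d where d: "symmetrizer A d"
    using crystals[OF \<rho>] unfolding simple_module_crystal_def by blast
  have "independent_columns A"
    by (rule independent_columnsI[OF crys[OF \<rho>], of "u \<rho>" d])
      (use u[OF \<rho>] d in \<open>simp_all add: \<rho>_def symmetrizer_def\<close>)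
  then have "crystal_family A B u"
    using crys u monoidal by unfold_locales auto
  then show ?thesis by blast
qed

section \<open>The basis\<close>

lemma lin_in_gcrys_hom: "morphism C D f \<Longrightarrow> lin C f \<in> gcrys_hom C D"
  unfolding gcrys_hom_def
  by (rule module.span_base[OF vector_space_map_scale[folded module_iff_vector_space]]) blast

context crystal_family
begin

lemma diagram_lower:
  assumes \<beta>: "is_crossings B \<beta>" and D: "is_diagram_system B \<beta> D"
    and h: "highest (W w) h" and k: "highest (W w) k" "k \<noteq> h" "snd (D w h) k = Some y"
  shows "weight_le A (wt (W w) k) (wt (W w) h) \<and> wt (W w) k \<noteq> wt (W w) h"
proof -
  define c \<phi> where "c = fst (D w h)" and "\<phi> = snd (D w h)"
  have m: "morphism (W w) (W c) \<phi>" and p: "pinj (W w) \<phi>" and top: "\<phi> h = Some (top_word c)"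
    using diagram_props[OF \<beta> D h] by (simp_all add: c_def \<phi>_def)
  have hk: "h \<in> elts (W w)" "k \<in> elts (W w)" using h k(1) by (simp_all add: highest_def)
  have y: "\<phi> k = Some y" using k(3) by (simp add: \<phi>_def)
  have "wt (W w) h = word_weight c" using morphism_wt[OF m hk(1) top] by (simp add: top_word_elts)
  moreover have "wt (W w) k = wt (W c) y" using morphism_wt[OF m hk(2) y] by simp
  \<comment> \<open>Injectivity outside the kernel keeps the image of \<open>k\<close> apart from
    that of \<open>h\<close>.\<close>
  moreover have "y \<noteq> top_word c" using pinjD[OF p hk(1,2) top] y k(2) by auto
  ultimately show ?thesis using word_wt_le[OF morphism_elts[OF m hk(2) y]] by auto
qed

lemma word_weight_diagram:
  assumes \<beta>: "is_crossings B \<beta>" and D: "is_diagram_system B \<beta> D" and h: "highest (W w) h"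
  shows "word_weight (fst (D w h)) = wt (W w) h"
  using diagram_props[OF assms] morphism_wt[of "W w" "W (fst (D w h))" "snd (D w h)" h "top_word (fst (D w h))"] h
  by (simp add: highest_def top_word_elts)

lemma highest_dominant: "highest (W w) h \<Longrightarrow> dominant (wt (W w) h)"
  unfolding dominant_def by (metis highest_phi of_nat_0_le_iff)

lemma diagrams_basis:
  fixes \<epsilon> \<epsilon>' :: "'n list" and \<B> :: "(('b list \<Rightarrow> 'k::field) \<Rightarrow> ('b list \<Rightarrow> 'k)) set"
  assumes \<beta>: "is_crossings B \<beta>" and D: "is_diagram_system B \<beta> D"
    and P: "\<And>\<mu> f g. dominant \<mu> \<Longrightarrow> f \<in> diagrams B D \<epsilon>' \<mu> \<Longrightarrow> g \<in> diagrams B D \<epsilon> \<mu> \<Longrightarrow>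
      is_permutation (fst g) (P f g) (fst f)"
    and \<B>: "\<B> = {lin (W \<epsilon>) (flip (W \<epsilon>') (snd f) \<circ>\<^sub>0 crossing_map \<beta> (fst g) (P f g) \<circ>\<^sub>0 snd g)
      | f g \<mu>. dominant \<mu> \<and> f \<in> diagrams B D \<epsilon>' \<mu> \<and> g \<in> diagrams B D \<epsilon> \<mu>}"
  shows "\<not> module.dependent map_scale \<B> \<and> module.span map_scale \<B> = gcrys_hom (W \<epsilon>) (W \<epsilon>')"
proof -
  interpret vector_space "map_scale :: 'k \<Rightarrow> (('b list \<Rightarrow> 'k) \<Rightarrow> ('b list \<Rightarrow> 'k)) \<Rightarrow> _"
    by (rule vector_space_map_scale)
  define I where "I = {(h, h'). highest (W \<epsilon>) h \<and> highest (W \<epsilon>') h' \<and> wt (W \<epsilon>') h' = wt (W \<epsilon>) h}"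
  define m where "m = (\<lambda>(h, h'). flip (W \<epsilon>') (snd (D \<epsilon>' h'))
    \<circ>\<^sub>0 crossing_map \<beta> (fst (D \<epsilon> h)) (P (D \<epsilon>' h') (D \<epsilon> h)) \<circ>\<^sub>0 snd (D \<epsilon> h))"
  define \<Phi> :: "_ \<Rightarrow> ('b list \<Rightarrow> 'k) \<Rightarrow> 'b list \<Rightarrow> 'k" where "\<Phi> = (\<lambda>p. lin (W \<epsilon>) (m p))"
  define wts where "wts = wt (W \<epsilon>) ` elts (W \<epsilon>)"
  \<comment> \<open>Counts the weights of the domain strictly below that of \<open>h\<close>,
    turning the root order into a rank in the naturals.\<close>
  define r where "r = (\<lambda>(h, h' :: 'b list). card {\<nu>\<in>wts. weight_le A \<nu> (wt (W \<epsilon>) h) \<and> \<nu> \<noteq> wt (W \<epsilon>) h})"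
  define \<tau> where "\<tau> = (\<lambda>(h, h') (T :: ('b list \<Rightarrow> 'k) \<Rightarrow> 'b list \<Rightarrow> 'k). T (\<delta> h) h')"
  note fin = crys_finite[OF crys_word]
  have mem: "D w h \<in> diagrams B D w (wt (W w) h)" if "highest (W w) h" for w h
    using that word_weight_diagram[OF \<beta> D that] by (auto simp: diagrams_def)
  have m: "morphism (W \<epsilon>) (W \<epsilon>') (m p) \<and> m p (fst p) = Some (snd p)" if "p \<in> I" for p
  proof -
    obtain h h' where p: "p = (h, h')" by (cases p)
    then have h: "highest (W \<epsilon>) h" and h': "highest (W \<epsilon>') h'" and eq: "wt (W \<epsilon>') h' = wt (W \<epsilon>) h"
      using that by (auto simp: I_def)
    have perm: "is_permutation (fst (D \<epsilon> h)) (P (D \<epsilon>' h') (D \<epsilon> h)) (fst (D \<epsilon>' h'))"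
      using P[OF highest_dominant[OF h] mem[OF h', unfolded eq] mem[OF h]] .
    note g = diagram_props[OF \<beta> D h] and f = diagram_props[OF \<beta> D h'] and \<pi> = permutation_props[OF \<beta> perm]
    have f_inj: "pinj (W \<epsilon>') (snd (D \<epsilon>' h'))" using f by blast
    have "morphism (W (fst (D \<epsilon>' h'))) (W \<epsilon>') (flip (W \<epsilon>') (snd (D \<epsilon>' h')))"
      using f by (intro morphism_flip[OF crys_word crys_word]) simp_all
    moreover have "flip (W \<epsilon>') (snd (D \<epsilon>' h')) (top_word (fst (D \<epsilon>' h'))) = Some h'"
      using f h' by (simp add: flip_Some[OF f_inj] highest_def)
    ultimately show ?thesis
      unfolding p m_def prod.case fst_conv snd_conv
      using g \<pi>(3) by (intro conjI morphism_comp[OF morphism_comp[OF _ \<pi>(1)]]) (simp_all add: comp_map_def)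
  qed
  have tri: "p = q \<or> r p < r q" if p: "p \<in> I" and q: "q \<in> I" and ne: "m q (fst p) = Some (snd p)" for p q
  proof (cases "fst p = fst q")
    case True
    \<comment> \<open>The rank ignores second entries; pairs sharing the first are told apart
      because \<open>m q\<close> sends \<open>fst q\<close> to \<open>snd q\<close>.\<close>
    then show ?thesis using m[OF q] ne by (simp add: prod_eq_iff)
  next
    case False
    have h: "highest (W \<epsilon>) (fst q)" "highest (W \<epsilon>) (fst p)" using p q by (auto simp: I_def)
    obtain y where "snd (D \<epsilon> (fst q)) (fst p) = Some y"
      using ne by (auto simp: m_def comp_map_def split_beta bind_eq_Some_conv)
    from diagram_lower[OF \<beta> D h False this]
    have lt: "weight_le A (wt (W \<epsilon>) (fst p)) (wt (W \<epsilon>) (fst q))" "wt (W \<epsilon>) (fst p) \<noteq> wt (W \<epsilon>) (fst q)"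
      by auto
    have "{\<nu>\<in>wts. weight_le A \<nu> (wt (W \<epsilon>) (fst p)) \<and> \<nu> \<noteq> wt (W \<epsilon>) (fst p)}
      \<subset> {\<nu>\<in>wts. weight_le A \<nu> (wt (W \<epsilon>) (fst q)) \<and> \<nu> \<noteq> wt (W \<epsilon>) (fst q)}"
    proof
      show "{\<nu>\<in>wts. weight_le A \<nu> (wt (W \<epsilon>) (fst p)) \<and> \<nu> \<noteq> wt (W \<epsilon>) (fst p)}
        \<subseteq> {\<nu>\<in>wts. weight_le A \<nu> (wt (W \<epsilon>) (fst q)) \<and> \<nu> \<noteq> wt (W \<epsilon>) (fst q)}"
        using lt weight_le_trans[OF _ lt(1)] weight_le_antisym[OF indep] by blast
      have "wt (W \<epsilon>) (fst p) \<in> wts" using h(2) by (simp add: wts_def highest_def)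
      then show "{\<nu>\<in>wts. weight_le A \<nu> (wt (W \<epsilon>) (fst p)) \<and> \<nu> \<noteq> wt (W \<epsilon>) (fst p)}
        \<noteq> {\<nu>\<in>wts. weight_le A \<nu> (wt (W \<epsilon>) (fst q)) \<and> \<nu> \<noteq> wt (W \<epsilon>) (fst q)}"
        using lt by blast
    qed
    then have "r p < r q" unfolding r_def split_beta by (intro psubset_card_mono) (simp add: wts_def fin)
    then show ?thesis ..
  qed
  have basis: "independent (\<Phi> ` I) \<and> span (\<Phi> ` I) = gcrys_hom (W \<epsilon>) (W \<epsilon>')"
  proof (rule triangular_basis[where \<tau> = \<tau> and r = r])
    have "I \<subseteq> elts (W \<epsilon>) \<times> elts (W \<epsilon>')" by (auto simp: I_def highest_def)
    then show "finite I" by (rule finite_subset) (simp add: fin)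
    show "\<tau> p (x + y) = \<tau> p x + \<tau> p y" for p x y by (simp add: \<tau>_def split_beta)
    show "\<tau> p (map_scale a x) = a * \<tau> p x" for p a x by (simp add: \<tau>_def split_beta map_scale_def)
    show "\<tau> p (\<Phi> p) = 1" if "p \<in> I" for p
      using m[OF that] that by (auto simp: \<tau>_def \<Phi>_def lin_\<delta>[OF fin] I_def highest_def)
    show "p = q \<or> r p < r q" if "p \<in> I" "q \<in> I" "\<tau> p (\<Phi> q) \<noteq> 0" for p q
    proof (rule tri[OF that(1,2)])
      show "m q (fst p) = Some (snd p)"
        using that(3) by (simp add: \<tau>_def \<Phi>_def split_beta lin_\<delta>[OF fin] split: if_splits)
    qed
    show "subspace (gcrys_hom (W \<epsilon>) (W \<epsilon>'))" unfolding gcrys_hom_def by (rule subspace_span)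
    show "\<Phi> ` I \<subseteq> gcrys_hom (W \<epsilon>) (W \<epsilon>')"
      unfolding \<Phi>_def using m lin_in_gcrys_hom by blast
    fix T assume T: "T \<in> gcrys_hom (W \<epsilon>) (W \<epsilon>')" and 0: "\<And>p. p \<in> I \<Longrightarrow> \<tau> p T = 0"
    show "T = 0"
    proof (rule crystal_linear_eq_0[OF crys_word crystal_linear_hom[OF crys_word crys_word T] word_lowered])
      show "T (\<delta> h) h' = 0" if "highest (W \<epsilon>) h" "highest (W \<epsilon>') h'" "wt (W \<epsilon>') h' = wt (W \<epsilon>) h" for h h'
        using 0[of "(h, h')"] that by (simp add: I_def \<tau>_def)
    qed
  qed
  have "\<B> = \<Phi> ` I"
  proof (intro set_eqI iffI)
    fix T assume "T \<in> \<B>"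
    then obtain \<mu> f g where f: "f \<in> diagrams B D \<epsilon>' \<mu>" and g: "g \<in> diagrams B D \<epsilon> \<mu>"
      and T: "T = lin (W \<epsilon>) (flip (W \<epsilon>') (snd f) \<circ>\<^sub>0 crossing_map \<beta> (fst g) (P f g) \<circ>\<^sub>0 snd g)"
      unfolding \<B> by blast
    obtain h' where h': "highest (W \<epsilon>') h'" "f = D \<epsilon>' h'" "word_weight (fst f) = \<mu>"
      using f by (auto simp: diagrams_def)
    obtain h where h: "highest (W \<epsilon>) h" "g = D \<epsilon> h" "word_weight (fst g) = \<mu>"
      using g by (auto simp: diagrams_def)
    \<comment> \<open>A common codomain weight \<open>\<mu>\<close> means that \<open>h\<close> and
      \<open>h'\<close> have equal weight, since each diagram preserves the weight of its highest
      weight element.\<close>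
    have "(h, h') \<in> I"
      using h h' word_weight_diagram[OF \<beta> D h(1)] word_weight_diagram[OF \<beta> D h'(1)] by (simp add: I_def)
    then show "T \<in> \<Phi> ` I"
      using h(2) h'(2) T by (intro image_eqI[of _ _ "(h, h')"]) (simp_all add: m_def \<Phi>_def)
  next
    fix T assume "T \<in> \<Phi> ` I"
    then obtain h h' where h: "highest (W \<epsilon>) h" and h': "highest (W \<epsilon>') h'" and eq: "wt (W \<epsilon>') h' = wt (W \<epsilon>) h"
      and T: "T = \<Phi> (h, h')" by (auto simp: I_def)
    show "T \<in> \<B>"
      unfolding \<B> T \<Phi>_def m_def prod.case mem_Collect_eq
      using mem[OF h] mem[OF h', unfolded eq] highest_dominant[OF h] by blast
  qed
  then show ?thesis using basis by simp
qed

end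

theorem proposition2p3p6:
  fixes scale :: "complex \<Rightarrow> 'g::ab_group_add \<Rightarrow> 'g"
    and br :: "'g \<Rightarrow> 'g \<Rightarrow> 'g"
    and H :: "'g set"
    and \<alpha> :: "'n::{finite,linorder} \<Rightarrow> 'g \<Rightarrow> complex"
    and coroot :: "'n \<Rightarrow> 'g"
    and A :: "'n \<Rightarrow> 'n \<Rightarrow> int"
    and B :: "'n weight \<Rightarrow> ('n, 'b) crystal"
    and \<beta> :: "('n, 'b) crossings"
    and D :: "'n list \<Rightarrow> 'b list \<Rightarrow> ('n, 'b) diagram"
    and P :: "('n, 'b) diagram \<Rightarrow> ('n, 'b) diagram \<Rightarrow> nat list"
    and \<epsilon> \<epsilon>' :: "'n list"
    and \<B> Hom :: "(('b list \<Rightarrow> 'k::field) \<Rightarrow> ('b list \<Rightarrow> 'k)) set"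
  assumes lie: "simple_lie_algebra scale br H \<alpha> coroot"
    and A: "A = cartan_matrix \<alpha> coroot"
    and crystals: "\<And>\<mu>. dominant \<mu> \<Longrightarrow> simple_module_crystal A \<mu> (B \<mu>)"
    and monoidal: "\<And>\<mu> \<nu>. dominant \<mu> \<Longrightarrow> dominant \<nu> \<Longrightarrow> gcrys_object B (tensor (B \<mu>) (B \<nu>))"
    and crossings: "is_crossings B \<beta>"
    and diagrams: "is_diagram_system B \<beta> D"
    and permutations: "\<And>\<mu> f g. dominant \<mu> \<Longrightarrow> f \<in> diagrams B D \<epsilon>' \<mu> \<Longrightarrow> g \<in> diagrams B D \<epsilon> \<mu> \<Longrightarrow>
      is_permutation (fst g) (P f g) (fst f)"
    and Basis: "\<B> = {lin (word_crystal B \<epsilon>)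
        (flip (word_crystal B \<epsilon>') (snd f) \<circ>\<^sub>0 crossing_map \<beta> (fst g) (P f g) \<circ>\<^sub>0 snd g)
      | f g \<mu>. dominant \<mu> \<and> f \<in> diagrams B D \<epsilon>' \<mu> \<and> g \<in> diagrams B D \<epsilon> \<mu>}"
    and Hom: "Hom = gcrys_hom (word_crystal B \<epsilon>) (word_crystal B \<epsilon>')"
  shows "\<not> module.dependent map_scale \<B> \<and> module.span map_scale \<B> = Hom"
proof -
  have "A i i = 2" for i
    unfolding A by (rule simple_lie_algebra.cartan_matrix_diag[OF lie])
  from crystal_family_exists[OF this crystals monoidal] obtain u where "crystal_family A B u"
    by blast
  then show ?thesis
    unfolding Hom using crossings diagrams permutations Basis
    by (rule crystal_family.diagrams_basis)
qed

end
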